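(* Let $H_3$ be the Heisenberg group with its canonical metric, let $\rho\ge0$, and consider the Lorentz force $F_{e_1,\rho}$. Let $\sigma$ be the magnetic trajectory for $F_{e_1,\rho}$ with $\sigma(0)=e$ (the identity) and $\sigma'(0)=x_0e_1+y_0e_2+z_0e_3$. (a) If $x_0=0$ and $(y_0+1)(z_0+\rho)=\rho$, then $\sigma$ is $\lambda_r$-periodic with $\lambda_r=\exp(y_0r\,e_2+z_0r\,e_3)$ for any $r\ne0$. (b) In the case $x_0^2+(\rho-(y_0+1)(z_0+\rho))^2\ne0$: - if $\Delta\ne0$, or $\Delta=0$ and $\mu>0$, then, with $\omega$ the period defined in the context, $\sigma$ is periodic if $\sigma(\omega)=e$, or (otherwise) $\sigma$ is $\lambda$-periodic for $\lambda=\sigma(\omega)$; - if $\Delta=0$ and $\mu\le0$, then $\sigma$ is not $\lambda$-periodic for any $\lambda$.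
   Context: The Heisenberg group $H_3$ is $\mathbb{R}^3$ with product $(x_1,y_1,z_1)(x_2,y_2,z_2)=(x_1+x_2,\,y_1+y_2,\,z_1+z_2+\tfrac12(x_1y_2-x_2y_1))$. Its Lie algebra has basis of left-invariant fields $e_1=\partial_x-\tfrac12 y\,\partial_z$, $e_2=\partial_y+\tfrac12 x\,\partial_z$, $e_3=\partial_z$, with $[e_1,e_2]=e_3$; $\exp(xe_1+ye_2+ze_3)=(x,y,z)$. The canonical metric is the left-invariant metric for which $e_1,e_2,e_3$ is orthonormal. $F_{e_1,\rho}$ is the left-invariant skew-symmetric $(1,1)$-tensor with $F e_1=\rho e_2+e_3$, $F e_2=-\rho e_1$, $F e_3=-e_1$. A magnetic trajectory is a curve $\gamma:\mathbb{R}\to H_3$ with $\nabla_{\gamma'}\gamma'=F\gamma'$, $\nabla$ the Levi-Civita connection. A curve $\sigma$ is periodic if $\sigma(t+\omega)=\sigma(t)$ for all $t$ for some $\omega>0$. For $\lambda\in H_3$ different from the identity, $\sigma$ is $\lambda$-periodic with period $\omega\neq0$ if $\lambda\sigma(t)=\sigma(t+\omega)$ for all $t\in\mathbb{R}$. Define $p_0=2(y_0+1)-(z_0+\rho)^2$, $q_0=p_0^2+8\rho(z_0+\rho)-4(x_0^2+(y_0+1)^2)$ and the quartic polynomial $P(\eta)=-\tfrac14(\eta^4+2p_0\eta^2-8\rho\eta+q_0)$. $\Delta$ is the discriminant of $P$ and $r_1,r_2,r_3,r_4\in\mathbb{C}$ are its roots. If $\Delta=0$, under the hypothesis of (b), all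 roots of $P$ are real; $r$ denotes the multiple root and $\mu=\tfrac12(p_0+3r^2)$ (so $\mu=\tfrac14(r-r')(r-r'')$, with $r',r''$ the two other roots counted with multiplicity). The period $\omega$: with $K(k)=\int_0^{\pi/2}(1-k^2\sin^2\theta)^{-1/2}d\theta$, - if $\Delta<0$, $P$ has two real roots $r_1<r_4$ and two conjugate non-real roots $r_2,r_3$; put $\delta_1=|r_1-r_2|$, $\delta_4=|r_4-r_2|$, $k^2=\frac{(r_4-r_1)^2-(\delta_4-\delta_1)^2}{4\delta_1\delta_4}$; then $\omega=\frac{8K(k)}{\sqrt{\delta_1\delta_4}}$; - if $\Delta=0$ and $\mu>0$, $\omega=\frac{2\pi}{\sqrt\mu}$; - if $\Delta>0$, all roots are real, $r_1<r_2<r_3<r_4$; put $k=\sqrt{\frac{(r_4-r_3)(r_2-r_1)}{(r_4-r_2)(r_3-r_1)}}$; then $\omega=\frac{8K(k)}{\sqrt{(r_4-r_2)(r_3-r_1)}}$.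
   Formalization: In (a), when x_0=y_0=z_0=0 the trajectory is constant and λ_r=e, which the definition of λ-periodic excludes; in that case only, the conclusion is σ(t+r)=σ(t) for all t instead of λ_r-periodicity. *)

theory Defs
  imports "HOL-Analysis.Analysis" "HOL-Computational_Algebra.Fundamental_Theorem_Algebra"
begin

section \<open>Riemannian metrics in a global chart of R^n\<close>

text \<open>A metric is given by its Gram matrix field in the coordinate basis. Tangent vectors at a
  point are identified with vectors of R^n through the coordinate basis.\<close>

definition partial_deriv :: "'n::finite \<Rightarrow> (real^'n \<Rightarrow> real) \<Rightarrow> real^'n \<Rightarrow> real" where
  "partial_deriv i f p = frechet_derivative f (at p) (axis i 1)"

definition christoffel ::
    "(real^'n \<Rightarrow> real^'n^'n) \<Rightarrow> real^'n \<Rightarrow> 'n::finite \<Rightarrow> 'n \<Rightarrow> 'n \<Rightarrow> real" where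
  "christoffel g p k i j =
     (1/2) * (\<Sum>l\<in>UNIV. matrix_inv (g p) $ k $ l *
        (partial_deriv i (\<lambda>q. g q $ j $ l) p + partial_deriv j (\<lambda>q. g q $ i $ l) p
          - partial_deriv l (\<lambda>q. g q $ i $ j) p))"

definition velocity :: "(real \<Rightarrow> 'a::real_normed_vector) \<Rightarrow> real \<Rightarrow> 'a" where
  "velocity \<gamma> t = vector_derivative \<gamma> (at t)"

text \<open>Levi-Civita covariant derivative, along the curve \<open>\<gamma>\<close>, of a vector field \<open>V\<close> along \<open>\<gamma>\<close>.\<close>

definition cov_deriv ::
    "(real^'n \<Rightarrow> real^'n^'n) \<Rightarrow> (real \<Rightarrow> real^'n) \<Rightarrow> (real \<Rightarrow> real^'n) \<Rightarrow> real \<Rightarrow> real^'n::finite" where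
  "cov_deriv g \<gamma> V t =
     (\<chi> k. vector_derivative V (at t) $ k
        + (\<Sum>i\<in>UNIV. \<Sum>j\<in>UNIV. christoffel g (\<gamma> t) k i j * velocity \<gamma> t $ i * V t $ j))"

definition magnetic_trajectory ::
    "(real^'n \<Rightarrow> real^'n^'n) \<Rightarrow> (real^'n \<Rightarrow> real^'n \<Rightarrow> real^'n) \<Rightarrow> (real \<Rightarrow> real^'n::finite) \<Rightarrow> bool" where
  "magnetic_trajectory g F \<gamma> \<longleftrightarrow>
     (\<forall>t. \<gamma> differentiable (at t)) \<and> (\<forall>t. velocity \<gamma> differentiable (at t)) \<and>
     (\<forall>t. cov_deriv g \<gamma> (velocity \<gamma>) t = F (\<gamma> t) (velocity \<gamma> t))"

section \<open>The Heisenberg group\<close>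

text \<open>The identity element is \<open>0\<close>.\<close>

definition heis_mult :: "real^3 \<Rightarrow> real^3 \<Rightarrow> real^3" (infixl "\<odot>" 70) where
  "p \<odot> q = vector [p$1 + q$1, p$2 + q$2, p$3 + q$3 + (1/2) * (p$1 * q$2 - q$1 * p$2)]"

definition e1 :: "real^3 \<Rightarrow> real^3" where "e1 p = vector [1, 0, - (1/2) * p$2]"
definition e2 :: "real^3 \<Rightarrow> real^3" where "e2 p = vector [0, 1, (1/2) * p$1]"
definition e3 :: "real^3 \<Rightarrow> real^3" where "e3 p = vector [0, 0, 1]"

text \<open>A Lie algebra element is represented by its coefficients \<open>w\<close> with respect to
  \<open>e1, e2, e3\<close>; \<open>left_field w\<close> is the corresponding left-invariant field, and
  \<open>heis_coords p v\<close> are the coefficients of the tangent vector \<open>v\<close> in the frame at \<open>p\<close>.\<close>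

definition left_field :: "real^3 \<Rightarrow> real^3 \<Rightarrow> real^3" where
  "left_field w p = w$1 *\<^sub>R e1 p + w$2 *\<^sub>R e2 p + w$3 *\<^sub>R e3 p"

definition heis_coords :: "real^3 \<Rightarrow> real^3 \<Rightarrow> real^3" where
  "heis_coords p = inv (\<lambda>w. left_field w p)"

definition heis_metric :: "real^3 \<Rightarrow> real^3^3" where
  "heis_metric p = (\<chi> i j. heis_coords p (axis i 1) \<bullet> heis_coords p (axis j 1))"

text \<open>\<open>exp (x e1 + y e2 + z e3) = (x, y, z)\<close>; see lemma \<open>heis_exp_one_parameter\<close> below.\<close>

definition heis_exp :: "real^3 \<Rightarrow> real^3" where
  "heis_exp w = w"

definition lorentz_force :: "real \<Rightarrow> real^3 \<Rightarrow> real^3 \<Rightarrow> real^3" where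
  "lorentz_force \<rho> p v =
     (let w = heis_coords p v in
        w$1 *\<^sub>R (\<rho> *\<^sub>R e2 p + e3 p) + w$2 *\<^sub>R (- \<rho> *\<^sub>R e1 p) + w$3 *\<^sub>R (- e1 p))"

lemma heis_mult_nth [simp]:
  "(p \<odot> q) $ 1 = p$1 + q$1"
  "(p \<odot> q) $ 2 = p$2 + q$2"
  "(p \<odot> q) $ 3 = p$3 + q$3 + (1/2) * (p$1 * q$2 - q$1 * p$2)"
  by (simp_all add: heis_mult_def)

lemma heis_group:
  "(p \<odot> q) \<odot> r = p \<odot> (q \<odot> r)" "0 \<odot> p = p" "p \<odot> 0 = p" "p \<odot> (- p) = 0" "(- p) \<odot> p = 0"
  by (simp_all add: vec_eq_iff forall_3 algebra_simps)

lemma left_field_nth [simp]: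
  "left_field w p $ 1 = w$1"
  "left_field w p $ 2 = w$2"
  "left_field w p $ 3 = w$3 + (1/2) * (p$1 * w$2 - p$2 * w$1)"
  by (simp_all add: left_field_def e1_def e2_def e3_def algebra_simps)

lemma bij_left_field: "bij (\<lambda>w. left_field w p)"
proof (rule bij_betw_byWitness[where f' = "\<lambda>v. vector [v$1, v$2, v$3 - (1/2) * (p$1 * v$2 - p$2 * v$1)]"])
qed (auto simp: vec_eq_iff forall_3)

lemma heis_coords_left_field [simp]: "heis_coords p (left_field w p) = w"
  unfolding heis_coords_def using bij_left_field[of p] inv_f_f[of "\<lambda>w. left_field w p" w]
  by (simp add: bij_def)

lemma left_field_heis_coords [simp]: "left_field (heis_coords p v) p = v"
  unfolding heis_coords_def using bij_left_field[of p] surj_f_inv_f[of "\<lambda>w. left_field w p" v]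
  by (simp add: bij_def)

lemma heis_coords_eq:
  "heis_coords p v = vector [v$1, v$2, v$3 - (1/2) * (p$1 * v$2 - p$2 * v$1)]"
proof -
  have "v = left_field (vector [v$1, v$2, v$3 - (1/2) * (p$1 * v$2 - p$2 * v$1)]) p"
    by (simp add: vec_eq_iff forall_3)
  then show ?thesis by (metis heis_coords_left_field)
qed

lemma heis_metric_left_field:
  "left_field v p \<bullet> (heis_metric p *v left_field w p) = v \<bullet> w"
  by (simp add: heis_metric_def heis_coords_eq matrix_vector_mult_def inner_vec_def sum_3 axis_def
      algebra_simps add_divide_distrib diff_divide_distrib)

text \<open>\<open>left_field w\<close> is the left-invariant field with value \<open>w\<close> at the identity.\<close>

lemma left_field_left_invariant:
  "((\<lambda>t. p \<odot> (t *\<^sub>R w)) has_vector_derivative left_field w p) (at 0)"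
proof -
  have eq: "(\<lambda>t. p \<odot> (t *\<^sub>R w)) = (\<lambda>t. p + t *\<^sub>R left_field w p)"
    by (rule ext) (simp add: vec_eq_iff forall_3 algebra_simps)
  show ?thesis unfolding eq by (auto intro!: derivative_eq_intros)
qed

lemma heis_exp_one_parameter:
  "heis_exp (s *\<^sub>R w) \<odot> heis_exp (t *\<^sub>R w) = heis_exp ((s + t) *\<^sub>R w)"
  "((\<lambda>t. heis_exp (t *\<^sub>R w)) has_vector_derivative left_field w (heis_exp (t *\<^sub>R w))) (at t)"
proof -
  show "heis_exp (s *\<^sub>R w) \<odot> heis_exp (t *\<^sub>R w) = heis_exp ((s + t) *\<^sub>R w)"
    by (simp add: heis_exp_def vec_eq_iff forall_3 algebra_simps)
  have "left_field w (heis_exp (t *\<^sub>R w)) = w"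
    by (simp add: heis_exp_def vec_eq_iff forall_3 algebra_simps)
  then show "((\<lambda>t. heis_exp (t *\<^sub>R w)) has_vector_derivative left_field w (heis_exp (t *\<^sub>R w))) (at t)"
    by (auto simp: heis_exp_def intro!: derivative_eq_intros)
qed

section \<open>Periodicity\<close>

definition periodic_with :: "real \<Rightarrow> (real \<Rightarrow> real^3) \<Rightarrow> bool" where
  "periodic_with \<omega> \<sigma> \<longleftrightarrow> \<omega> > 0 \<and> (\<forall>t. \<sigma> (t + \<omega>) = \<sigma> t)"

definition lambda_periodic_with :: "real^3 \<Rightarrow> real \<Rightarrow> (real \<Rightarrow> real^3) \<Rightarrow> bool" where
  "lambda_periodic_with l \<omega> \<sigma> \<longleftrightarrow> l \<noteq> 0 \<and> \<omega> \<noteq> 0 \<and> (\<forall>t. l \<odot> \<sigma> t = \<sigma> (t + \<omega>))"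

definition lambda_periodic :: "real^3 \<Rightarrow> (real \<Rightarrow> real^3) \<Rightarrow> bool" where
  "lambda_periodic l \<sigma> \<longleftrightarrow> (\<exists>\<omega>. lambda_periodic_with l \<omega> \<sigma>)"

section \<open>The quartic and the period\<close>

text \<open>Some enumeration, with multiplicity, of the complex roots of a real polynomial.\<close>

definition complex_roots :: "real poly \<Rightarrow> complex list" where
  "complex_roots p = (SOME rs. mset rs = proots (map_poly complex_of_real p))"

text \<open>\<open>a^(2n-2) \<Prod>i<j (r_i - r_j)^2\<close>. The product is symmetric in the roots, hence independent of
  their enumeration, and it is a real number since the roots are closed under conjugation.\<close>

definition discriminant :: "real poly \<Rightarrow> real" where
  "discriminant p =
     (let rs = complex_roots p in
        lead_coeff p ^ (2 * degree p - 2) *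
        Re (\<Prod>j<length rs. \<Prod>i<j. (rs ! i - rs ! j)\<^sup>2))"

definition heis_p0 :: "real \<Rightarrow> real \<Rightarrow> real \<Rightarrow> real \<Rightarrow> real" where
  "heis_p0 \<rho> x0 y0 z0 = 2 * (y0 + 1) - (z0 + \<rho>)\<^sup>2"

definition heis_q0 :: "real \<Rightarrow> real \<Rightarrow> real \<Rightarrow> real \<Rightarrow> real" where
  "heis_q0 \<rho> x0 y0 z0 =
     (heis_p0 \<rho> x0 y0 z0)\<^sup>2 + 8 * \<rho> * (z0 + \<rho>) - 4 * (x0\<^sup>2 + (y0 + 1)\<^sup>2)"

definition heis_quartic :: "real \<Rightarrow> real \<Rightarrow> real \<Rightarrow> real \<Rightarrow> real poly" where
  "heis_quartic \<rho> x0 y0 z0 =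
     smult (- 1/4) [: heis_q0 \<rho> x0 y0 z0, - 8 * \<rho>, 2 * heis_p0 \<rho> x0 y0 z0, 0, 1 :]"

definition heis_disc :: "real \<Rightarrow> real \<Rightarrow> real \<Rightarrow> real \<Rightarrow> real" where
  "heis_disc \<rho> x0 y0 z0 = discriminant (heis_quartic \<rho> x0 y0 z0)"

text \<open>Only used when the discriminant vanishes and \<open>x0\<^sup>2 + (\<rho> - (y0 + 1) * (z0 + \<rho>))\<^sup>2 \<noteq> 0\<close>;
  then the quartic has exactly one multiple root, and it is real.\<close>

definition multiple_root :: "real poly \<Rightarrow> real" where
  "multiple_root p = (THE r. order r p \<ge> 2)"

definition heis_mu :: "real \<Rightarrow> real \<Rightarrow> real \<Rightarrow> real \<Rightarrow> real" where
  "heis_mu \<rho> x0 y0 z0 =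
     (1/2) * (heis_p0 \<rho> x0 y0 z0 + 3 * (multiple_root (heis_quartic \<rho> x0 y0 z0))\<^sup>2)"

definition ellipticK :: "real \<Rightarrow> real" where
  "ellipticK k = integral {0..pi/2} (\<lambda>\<theta>. 1 / sqrt (1 - k\<^sup>2 * (sin \<theta>)\<^sup>2))"

text \<open>For the case of two real roots \<open>r1 < r4\<close> and a pair of conjugate non-real roots; either
  member of the pair gives the same value.\<close>

definition period_two_real :: "real poly \<Rightarrow> real" where
  "period_two_real p =
     (let r1 = Min {x. poly p x = 0};
          r4 = Max {x. poly p x = 0};
          r2 = (SOME z. poly (map_poly complex_of_real p) z = 0 \<and> Im z \<noteq> 0);
          \<delta>1 = cmod (complex_of_real r1 - r2);
          \<delta>4 = cmod (complex_of_real r4 - r2);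
          k = sqrt (((r4 - r1)\<^sup>2 - (\<delta>4 - \<delta>1)\<^sup>2) / (4 * \<delta>1 * \<delta>4))
      in 8 * ellipticK k / sqrt (\<delta>1 * \<delta>4))"

text \<open>For the case of four real roots \<open>r1 < r2 < r3 < r4\<close>.\<close>

definition period_four_real :: "real poly \<Rightarrow> real" where
  "period_four_real p =
     (let rs = sorted_list_of_set {x. poly p x = 0};
          r1 = rs ! 0; r2 = rs ! 1; r3 = rs ! 2; r4 = rs ! 3;
          k = sqrt (((r4 - r3) * (r2 - r1)) / ((r4 - r2) * (r3 - r1)))
      in 8 * ellipticK k / sqrt ((r4 - r2) * (r3 - r1)))"

definition heis_period :: "real \<Rightarrow> real \<Rightarrow> real \<Rightarrow> real \<Rightarrow> real" where
  "heis_period \<rho> x0 y0 z0 =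
     (if heis_disc \<rho> x0 y0 z0 < 0 then period_two_real (heis_quartic \<rho> x0 y0 z0)
      else if heis_disc \<rho> x0 y0 z0 = 0 then 2 * pi / sqrt (heis_mu \<rho> x0 y0 z0)
      else period_four_real (heis_quartic \<rho> x0 y0 z0))"

end

(*
  In the left-invariant frame the velocity W of a magnetic trajectory satisfies W3' = W1, and
  x = W3 + rho solves x'' = P'(x)/2 with first integral x'^2 = P(x); the components W1, W2 are x' and
  a quadratic polynomial in x. By left translation, sigma(t + w) = sigma(w) sigma(t) holds for all t
  as soon as w is a period of x, and conversely a lambda-period of sigma is a period of x.

  Such motions in the quartic potential P are compared, by uniqueness for the ODE, with explicit ones.
  A Moebius change of variable turns P into (1 - y^2) H(y) with H > 0 on [-1, 1]; there y = cos(theta)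
  where theta' = sqrt(H(cos theta)), so the period is the integral of 1 / sqrt(H(cos theta)) over
  [0, 2 pi], and H is chosen so that this is a multiple of K(k). If P has a double root between its
  extreme roots, a periodic x would have to pass through that equilibrium.
*)
theory Submission
  imports Defs "HOL-Library.Periodic_Fun"
begin

text \<open>A Moebius map has three free parameters. Two are spent on sending the ends of the
  interval of motion to \<open>1\<close> and \<open>-1\<close>; the third is adapted to the other
  two roots. For a conjugate pair it makes the remaining factor \<open>H\<close> even; for two real
  roots on one side it sends the farther one to infinity, so that \<open>H\<close> becomes linear.
  Either way \<open>H (cos \<psi>)\<close> is
  \<open>c\<^sup>2 * (1 - k\<^sup>2 * (sin u)\<^sup>2)\<close>, with \<open>u = \<psi>\<close> in
  the first case and \<open>u = \<psi> / 2\<close> in the second. A full turn takes the time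
  \<open>4 * ellipticK k / c\<close>, and the leading coefficient -1/4 of the quartic makes
  \<open>c\<close> half of a square root; this is where the factor 8 in the periods comes from.

  The quartic has no cubic term, so its roots sum to zero. This fixes the cofactor of two known
  roots up to its constant term, and it turns \<mu> into a product of root differences whose sign
  tells on which side of the other two roots a double root lies.\<close>

section \<open>Left-invariant geometry of the Heisenberg group\<close>

lemma partial_deriv_eq:
  assumes "(f has_derivative f') (at p)"
  shows "partial_deriv i f p = f' (axis i 1)"
  unfolding partial_deriv_def using frechet_derivative_at[OF assms] by metis

lemma heis_metric_eq:
  "heis_metric p = vector [
     vector [1 + (p$2)\<^sup>2 / 4, - (p$1 * p$2) / 4, p$2 / 2],
     vector [- (p$1 * p$2) / 4, 1 + (p$1)\<^sup>2 / 4, - p$1 / 2],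
     vector [p$2 / 2, - p$1 / 2, 1]]"
  by (simp add: heis_metric_def heis_coords_eq inner_vec_def sum_3 axis_def vec_eq_iff forall_3
      power2_eq_square)

lemma matrix_inv_heis_metric:
  "matrix_inv (heis_metric p) = vector [
     vector [1, 0, - p$2 / 2],
     vector [0, 1, p$1 / 2],
     vector [- p$2 / 2, p$1 / 2, 1 + ((p$1)\<^sup>2 + (p$2)\<^sup>2) / 4]]" (is "_ = ?B")
proof -
  let ?A = "heis_metric p"
  have AB: "?A ** ?B = mat 1" "?B ** ?A = mat 1"
    by (simp_all add: heis_metric_eq vec_eq_iff forall_3 matrix_matrix_mult_def sum_3 mat_def
      field_simps power2_eq_square)
  \<comment> \<open>\<open>matrix_inv\<close> is a choice among two-sided inverses. The explicit
    inverse shows that one exists, and multiplying by it on the left identifies the chosen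
    one.\<close>
  then have "?A ** matrix_inv ?A = mat 1"
    unfolding matrix_inv_def by (metis (mono_tags, lifting) someI_ex)
  then have "?B ** (?A ** matrix_inv ?A) = ?B"
    by simp
  then show ?thesis
    unfolding matrix_mul_assoc AB matrix_mul_lid .
qed

text \<open>Writing the entries through the components of \<open>axis i 1\<close> treats the three
  directions at once; the third component never occurs because the metric does not depend on the
  third coordinate.\<close>

lemma partial_deriv_heis_metric:
  "partial_deriv i (\<lambda>q. heis_metric q $ a $ b) p =
     (vector [
       vector [p$2 * axis i 1 $ 2 / 2, - (p$1 * axis i 1 $ 2 + p$2 * axis i 1 $ 1) / 4, axis i 1 $ 2 / 2],
       vector [- (p$1 * axis i 1 $ 2 + p$2 * axis i 1 $ 1) / 4, p$1 * axis i 1 $ 1 / 2, - axis i 1 $ 1 / 2],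
       vector [axis i 1 $ 2 / 2, - axis i 1 $ 1 / 2, 0]] :: real^3^3) $ a $ b"
proof -
  note D = bounded_linear.has_derivative[OF bounded_linear_vec_nth]
  have "\<forall>a b. partial_deriv i (\<lambda>q. heis_metric q $ a $ b) p =
     (vector [
       vector [p$2 * axis i 1 $ 2 / 2, - (p$1 * axis i 1 $ 2 + p$2 * axis i 1 $ 1) / 4, axis i 1 $ 2 / 2],
       vector [- (p$1 * axis i 1 $ 2 + p$2 * axis i 1 $ 1) / 4, p$1 * axis i 1 $ 1 / 2, - axis i 1 $ 1 / 2],
       vector [axis i 1 $ 2 / 2, - axis i 1 $ 1 / 2, 0]] :: real^3^3) $ a $ b"
    unfolding forall_3 heis_metric_eq vector_3
    by (intro conjI; rule partial_deriv_eq[THEN trans], (rule derivative_eq_intros D refl | simp)+)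
  then show ?thesis by blast
qed

lemma has_vector_derivative_nth:
  "(f has_vector_derivative f') (at t) \<Longrightarrow> ((\<lambda>t. f t $ i) has_real_derivative f' $ i) (at t)"
  unfolding has_real_derivative_iff_has_vector_derivative
  by (rule bounded_linear.has_vector_derivative[OF bounded_linear_vec_nth])

lemma christoffel_heis:
  "christoffel heis_metric p k i j =
     (vector [
       vector [vector [0, p$2 / 4, 0], vector [p$2 / 4, - p$1 / 2, 1 / 2], vector [0, 1 / 2, 0]],
       vector [vector [- p$2 / 2, p$1 / 4, - 1 / 2], vector [p$1 / 4, 0, 0], vector [- 1 / 2, 0, 0]],
       vector [vector [- (p$1 * p$2) / 4, ((p$1)\<^sup>2 - (p$2)\<^sup>2) / 8, - p$1 / 4],
         vector [((p$1)\<^sup>2 - (p$2)\<^sup>2) / 8, p$1 * p$2 / 4, - p$2 / 4],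
         vector [- p$1 / 4, - p$2 / 4, 0]]] :: real^3^3^3) $ k $ i $ j"
proof -
  have "\<forall>k i j. christoffel heis_metric p k i j =
     (vector [
       vector [vector [0, p$2 / 4, 0], vector [p$2 / 4, - p$1 / 2, 1 / 2], vector [0, 1 / 2, 0]],
       vector [vector [- p$2 / 2, p$1 / 4, - 1 / 2], vector [p$1 / 4, 0, 0], vector [- 1 / 2, 0, 0]],
       vector [vector [- (p$1 * p$2) / 4, ((p$1)\<^sup>2 - (p$2)\<^sup>2) / 8, - p$1 / 4],
         vector [((p$1)\<^sup>2 - (p$2)\<^sup>2) / 8, p$1 * p$2 / 4, - p$2 / 4],
         vector [- p$1 / 4, - p$2 / 4, 0]]] :: real^3^3^3) $ k $ i $ j"
    unfolding forall_3 christoffel_def partial_deriv_heis_metric matrix_inv_heis_metric sum_3 vector_3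
    by (intro conjI; simp add: axis_def field_simps power2_eq_square)
  then show ?thesis by blast
qed

text \<open>\<open>V t $ 1\<close>, \<open>V t $ 2\<close> and \<open>w t\<close> are the frame
  coefficients of the velocity. In the frame the Christoffel terms lose their dependence on the base
  point and collapse to the quadratic terms of the Euler equation on the Lie algebra.\<close>

lemma cov_deriv_heis:
  assumes "V = velocity \<gamma>"
  defines "A \<equiv> \<lambda>t. vector_derivative V (at t)"
  defines "w \<equiv> \<lambda>t. V t $ 3 - (1/2) * (\<gamma> t $ 1 * V t $ 2 - \<gamma> t $ 2 * V t $ 1)"
  shows "heis_coords (\<gamma> t) (cov_deriv heis_metric \<gamma> V t) =
    vector [A t $ 1 + V t $ 2 * w t, A t $ 2 - V t $ 1 * w t,
      A t $ 3 - (1/2) * (\<gamma> t $ 1 * A t $ 2 - \<gamma> t $ 2 * A t $ 1)]"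
  unfolding A_def w_def assms(1) vec_eq_iff forall_3 heis_coords_eq vector_3 cov_deriv_def
    christoffel_heis vec_lambda_beta sum_3
  by (intro conjI; simp add: field_simps power2_eq_square)

lemma heis_coords_lorentz_force:
  "heis_coords p (lorentz_force \<rho> p v) =
    (let w = heis_coords p v in vector [- \<rho> * w$2 - w$3, \<rho> * w$1, w$1])"
  by (simp add: lorentz_force_def Let_def e1_def e2_def e3_def heis_coords_eq vec_eq_iff forall_3
      algebra_simps)

lemma magnetic_trajectory_heis:
  assumes "magnetic_trajectory heis_metric (lorentz_force \<rho>) \<sigma>"
  defines "W \<equiv> \<lambda>t. heis_coords (\<sigma> t) (velocity \<sigma> t)"
  shows "(\<sigma> has_vector_derivative left_field (W t) (\<sigma> t)) (at t)"
    "((\<lambda>t. W t $ 1) has_real_derivative - W t $ 2 * W t $ 3 - \<rho> * W t $ 2 - W t $ 3) (at t)"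
    "((\<lambda>t. W t $ 2) has_real_derivative W t $ 1 * W t $ 3 + \<rho> * W t $ 1) (at t)"
    "((\<lambda>t. W t $ 3) has_real_derivative W t $ 1) (at t)"
proof -
  let ?V = "velocity \<sigma>"
  let ?A = "\<lambda>t. vector_derivative ?V (at t)"
  have s: "(\<sigma> has_vector_derivative ?V t) (at t)" and V: "(?V has_vector_derivative ?A t) (at t)"
    for t
    using assms(1) unfolding magnetic_trajectory_def velocity_def
    by (auto simp flip: vector_derivative_works)
  show "(\<sigma> has_vector_derivative left_field (W t) (\<sigma> t)) (at t)"
    using s by (simp add: W_def)
  note d = has_vector_derivative_nth[OF s] has_vector_derivative_nth[OF V]
  have W: "W = (\<lambda>t. vector [?V t $ 1, ?V t $ 2, ?V t $ 3 - (1/2) * (\<sigma> t $ 1 * ?V t $ 2 - \<sigma> t $ 2 * ?V t $ 1)])"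
    by (simp add: W_def heis_coords_eq)
  have "heis_coords (\<sigma> t) (cov_deriv heis_metric \<sigma> ?V t) =
      heis_coords (\<sigma> t) (lorentz_force \<rho> (\<sigma> t) (?V t))" for t
    using assms(1) unfolding magnetic_trajectory_def by simp
  then have eq: "?A t $ 1 + W t $ 2 * W t $ 3 = - \<rho> * W t $ 2 - W t $ 3"
    "?A t $ 2 - W t $ 1 * W t $ 3 = \<rho> * W t $ 1"
    "?A t $ 3 - (1/2) * (\<sigma> t $ 1 * ?A t $ 2 - \<sigma> t $ 2 * ?A t $ 1) = W t $ 1" for t
    unfolding cov_deriv_heis[OF refl] heis_coords_lorentz_force
    by (simp_all add: Let_def vec_eq_iff forall_3 heis_coords_eq W)
  show "((\<lambda>t. W t $ 1) has_real_derivative - W t $ 2 * W t $ 3 - \<rho> * W t $ 2 - W t $ 3) (at t)"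
    proof -
    have "W t $ 1 = ?V t $ 1" for t by (simp add: W)
    then show ?thesis using d(2)[of 1 t] eq(1)[of t] by (auto elim!: DERIV_cong)
  qed
  show "((\<lambda>t. W t $ 2) has_real_derivative W t $ 1 * W t $ 3 + \<rho> * W t $ 1) (at t)"
    proof -
    have "W t $ 2 = ?V t $ 2" for t by (simp add: W)
    then show ?thesis using d(2)[of 2 t] eq(2)[of t] by (auto elim!: DERIV_cong)
  qed
  \<comment> \<open>The products of two velocity components that arise from differentiating
    \<open>\<sigma>\<close> cancel, so only the third frame component of the coordinate acceleration
    is left.\<close>
  have "((\<lambda>t. ?V t $ 3 - (1/2) * (\<sigma> t $ 1 * ?V t $ 2 - \<sigma> t $ 2 * ?V t $ 1)) has_real_derivative W t $ 1) (at t)"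
    by (rule derivative_eq_intros d refl)+ (use eq(3)[of t] in \<open>simp add: field_simps\<close>)
  then show "((\<lambda>t. W t $ 3) has_real_derivative W t $ 1) (at t)"
    by (simp add: W)
qed

text \<open>With equal left-invariant velocities the first two coordinates of the curves differ by
  constants. Inserting these constants makes the defect in the third coordinate constant as
  well.\<close>

lemma left_translate_unique:
  assumes s: "\<And>t. (\<sigma> has_vector_derivative left_field (W t) (\<sigma> t)) (at t)" "\<sigma> 0 = 0"
    and t: "\<And>t. (\<tau> has_vector_derivative left_field (W t) (\<tau> t)) (at t)"
  shows "\<tau> t = \<tau> 0 \<odot> \<sigma> t"
proof -
  note d = has_vector_derivative_nth[OF s(1)] has_vector_derivative_nth[OF t]
  have c: "f t = f 0" if "\<And>t. (f has_real_derivative 0) (at t)" for f :: "real \<Rightarrow> real" and t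
    using DERIV_isconst_all that by blast
  define g where "g = \<tau> 0"
  have 1: "\<tau> t $ 1 = g $ 1 + \<sigma> t $ 1" for t
    using c[of "\<lambda>t. \<tau> t $ 1 - \<sigma> t $ 1" t] by (force intro!: derivative_eq_intros d simp: s(2) g_def)
  have 2: "\<tau> t $ 2 = g $ 2 + \<sigma> t $ 2" for t
    using c[of "\<lambda>t. \<tau> t $ 2 - \<sigma> t $ 2" t] by (force intro!: derivative_eq_intros d simp: s(2) g_def)
  have "((\<lambda>t. \<tau> t $ 3 - \<sigma> t $ 3 - (1/2) * (g $ 1 * \<sigma> t $ 2 - \<sigma> t $ 1 * g $ 2)) has_real_derivative 0) (at t)" for t
    by (rule derivative_eq_intros d refl)+ (simp add: 1 2 algebra_simps)
  from c[OF this, of t] have "\<tau> t $ 3 = g $ 3 + \<sigma> t $ 3 + (1/2) * (g $ 1 * \<sigma> t $ 2 - \<sigma> t $ 1 * g $ 2)"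
    by (simp add: s(2) g_def)
  with 1 2 show ?thesis by (simp add: vec_eq_iff forall_3 g_def[symmetric])
qed

section \<open>Motion in a polynomial potential\<close>

text \<open>The second-order equation is kept beside its first integral because the latter alone
  does not determine the motion: resting at a simple root of \<open>R\<close> satisfies it
  too.\<close>

definition energy_solution :: "real poly \<Rightarrow> (real \<Rightarrow> real) \<Rightarrow> (real \<Rightarrow> real) \<Rightarrow> bool" where
  "energy_solution R X X' \<longleftrightarrow>
     (\<forall>t. (X has_real_derivative X' t) (at t) \<and>
       (X' has_real_derivative poly (pderiv R) (X t) / 2) (at t) \<and> (X' t)\<^sup>2 = poly R (X t))"

lemma energy_solutionD:
  assumes "energy_solution R X X'"
  shows "(X has_real_derivative X' t) (at t)"
    "(X' has_real_derivative poly (pderiv R) (X t) / 2) (at t)" "(X' t)\<^sup>2 = poly R (X t)"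
  using assms by (auto simp: energy_solution_def)

lemma energy_solution_shift:
  assumes "energy_solution R X X'"
  shows "energy_solution R (\<lambda>t. X (t + s)) (\<lambda>t. X' (t + s))"
  using assms by (simp add: energy_solution_def DERIV_shift[of X, symmetric] DERIV_shift[of X', symmetric])

lemma energy_solution_const:
  "poly R a = 0 \<Longrightarrow> poly (pderiv R) a = 0 \<Longrightarrow> energy_solution R (\<lambda>_. a) (\<lambda>_. 0)"
  by (simp add: energy_solution_def)

lemma energy_solution_cont:
  "energy_solution R X X' \<Longrightarrow> continuous_on S X"
  by (meson DERIV_continuous_on energy_solutionD(1) has_field_derivative_at_within)

lemma poly_lipschitz_on_cball:
  fixes p :: "real poly"
  obtains L where "L \<ge> 0" "\<And>x y. \<bar>x\<bar> \<le> B \<Longrightarrow> \<bar>y\<bar> \<le> B \<Longrightarrow> \<bar>poly p x - poly p y\<bar> \<le> L * \<bar>x - y\<bar>"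
proof -
  have "bounded (poly (pderiv p) ` {-B..B})"
    by (intro compact_imp_bounded compact_continuous_image continuous_intros) auto
  then obtain L where L: "L > 0" "\<And>x. x \<in> {-B..B} \<Longrightarrow> \<bar>poly (pderiv p) x\<bar> \<le> L"
    unfolding bounded_pos by auto
  have "norm (poly p x - poly p y) \<le> L * norm (x - y)" if "\<bar>x\<bar> \<le> B" "\<bar>y\<bar> \<le> B" for x y
    by (rule field_differentiable_bound[of "{-B..B}" "poly p" "poly (pderiv p)"])
      (use that L in \<open>auto intro: poly_DERIV has_field_derivative_at_within\<close>)
  with L(1) show ?thesis by (intro that[of L]) auto
qed

text \<open>Gronwall's argument for the squared distance of the two solutions in the phase plane.\<close>

lemma energy_solution_unique_forward:
  assumes X: "energy_solution R X X'" and Y: "energy_solution R Y Y'"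
    and eq: "X 0 = Y 0" "X' 0 = Y' 0" and "T \<ge> 0"
  shows "X T = Y T"
proof -
  let ?F = "\<lambda>x. poly (pderiv R) x / 2"
  \<comment> \<open>The force is only locally Lipschitz, so both solutions are first confined to a
    common ball on the compact time interval.\<close>
  have "bounded (X ` {0..T} \<union> Y ` {0..T})"
    by (intro bounded_Un[THEN iffD2] conjI compact_imp_bounded compact_continuous_image
        energy_solution_cont[OF X] energy_solution_cont[OF Y]) auto
  then have "\<exists>B. \<forall>t\<in>{0..T}. \<bar>X t\<bar> \<le> B \<and> \<bar>Y t\<bar> \<le> B"
    unfolding bounded_iff by (auto simp: ball_Un)
  then obtain B where B: "\<And>t. t \<in> {0..T} \<Longrightarrow> \<bar>X t\<bar> \<le> B" "\<And>t. t \<in> {0..T} \<Longrightarrow> \<bar>Y t\<bar> \<le> B"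
    by blast
  obtain L where L: "L \<ge> 0" "\<And>x y. \<bar>x\<bar> \<le> B \<Longrightarrow> \<bar>y\<bar> \<le> B \<Longrightarrow>
      \<bar>poly (smult (1/2) (pderiv R)) x - poly (smult (1/2) (pderiv R)) y\<bar> \<le> L * \<bar>x - y\<bar>"
    using poly_lipschitz_on_cball[of B "smult (1/2) (pderiv R)"] by blast
  define d where "d t = (X t - Y t)\<^sup>2 + (X' t - Y' t)\<^sup>2" for t
  define d' where "d' t = 2 * (X t - Y t) * (X' t - Y' t) + 2 * (X' t - Y' t) * (?F (X t) - ?F (Y t))" for t
  note D = energy_solutionD(1,2)[OF X] energy_solutionD(1,2)[OF Y]
  have d: "(d has_real_derivative d' t) (at t)" for t
    unfolding d_def[abs_def] d'_def by (auto intro!: derivative_eq_intros D simp: field_simps)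
  have d': "d' t \<le> (1 + L) * d t" if "t \<in> {0..T}" for t
  proof -
    let ?a = "X t - Y t" and ?b = "X' t - Y' t"
    have *: "2 * \<bar>?a\<bar> * \<bar>?b\<bar> \<le> d t"
      using sum_squares_bound[of "\<bar>?a\<bar>" "\<bar>?b\<bar>"] by (simp add: d_def)
    have "d' t \<le> 2 * \<bar>?a\<bar> * \<bar>?b\<bar> + 2 * \<bar>?b\<bar> * \<bar>?F (X t) - ?F (Y t)\<bar>"
      unfolding d'_def by (intro add_mono) (metis abs_ge_self abs_mult abs_numeral)+
    also have "\<dots> \<le> 2 * \<bar>?a\<bar> * \<bar>?b\<bar> + 2 * \<bar>?b\<bar> * (L * \<bar>?a\<bar>)"
      using L(2)[OF B[OF that]] by (intro add_left_mono mult_left_mono) auto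
    also have "\<dots> = (1 + L) * (2 * \<bar>?a\<bar> * \<bar>?b\<bar>)" by (simp add: algebra_simps)
    also have "\<dots> \<le> (1 + L) * d t" using L(1) * by (intro mult_left_mono) auto
    finally show ?thesis .
  qed
  let ?h = "\<lambda>t. exp (- (1 + L) * t) * d t"
  have "?h T \<le> ?h 0"
  proof (rule DERIV_nonpos_imp_nonincreasing[OF \<open>T \<ge> 0\<close>])
    fix t assume t: "0 \<le> t" "t \<le> T"
    have "(?h has_real_derivative exp (- (1 + L) * t) * (d' t - (1 + L) * d t)) (at t)"
      by (auto intro!: derivative_eq_intros d simp: algebra_simps)
    moreover have "exp (- (1 + L) * t) * (d' t - (1 + L) * d t) \<le> 0"
      using d'[of t] t by (intro mult_nonneg_nonpos) auto
    ultimately show "\<exists>y. (?h has_real_derivative y) (at t) \<and> y \<le> 0" by blast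
  qed
  then have "d T \<le> 0" using eq by (simp add: d_def mult_le_0_iff)
  then have "(X T - Y T)\<^sup>2 \<le> 0" unfolding d_def using zero_le_power2[of "X' T - Y' T"] by linarith
  then show ?thesis by simp
qed

lemma energy_solution_reverse:
  assumes "energy_solution R X X'"
  shows "energy_solution R (\<lambda>t. X (- t)) (\<lambda>t. - X' (- t))"
proof -
  note D = energy_solutionD[OF assms]
  show ?thesis unfolding energy_solution_def
    using D(3) D(1)[of "- t" for t, unfolded DERIV_mirror]
      DERIV_minus[OF D(2)[of "- t" for t, unfolded DERIV_mirror]]
    by simp
qed

lemma energy_solution_unique:
  assumes X: "energy_solution R X X'" and Y: "energy_solution R Y Y'"
    and "X s = Y s" "X' s = Y' s"
  shows "X t = Y t"
proof (cases "t \<ge> s")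
  case True
  show ?thesis
    using energy_solution_unique_forward[OF energy_solution_shift[OF X, of s]
        energy_solution_shift[OF Y, of s], of "t - s"] assms True by simp
next
  case False
  show ?thesis
    using energy_solution_unique_forward[OF energy_solution_reverse[OF energy_solution_shift[OF X, of s]]
        energy_solution_reverse[OF energy_solution_shift[OF Y, of s]], of "s - t"] assms False by simp
qed

text \<open>A multiple root is an equilibrium, and by uniqueness no other motion can reach it in
  finite time.\<close>

lemma energy_solution_at_double_root:
  assumes X: "energy_solution R X X'" and "poly R (X s) = 0" "poly (pderiv R) (X s) = 0"
  shows "X t = X s"
  by (rule energy_solution_unique[OF X energy_solution_const[OF assms(2,3)], of s t])
    (use energy_solutionD(3)[OF X, of s] assms in auto)

text \<open>The determinant \<open>D\<close> governs the derivative of the map,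
  \<open>D / (s + r * x)\<^sup>2\<close>. Its square in front of \<open>P\<close> is what the first
  integral of the transformed motion requires.\<close>

lemma energy_solution_moebius:
  fixes p q r s :: real and P R :: "real poly"
  defines "D \<equiv> q * s - p * r"
  assumes X: "energy_solution P X X'" and D: "D \<noteq> 0" and s: "\<And>t. s + r * X t \<noteq> 0"
    and eq: "\<And>x. s + r * x \<noteq> 0 \<Longrightarrow> poly R ((p + q * x) / (s + r * x)) = D\<^sup>2 / (s + r * x) ^ 4 * poly P x"
  shows "energy_solution R (\<lambda>t. (p + q * X t) / (s + r * X t)) (\<lambda>t. D / (s + r * X t)\<^sup>2 * X' t)"
  unfolding energy_solution_def
proof (intro allI conjI)
  fix t
  note d = energy_solutionD[OF X, of t]
  let ?x = "X t" and ?e = "s + r * X t"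
  have N: "((\<lambda>x. (p + q * x) / (s + r * x)) has_real_derivative D / (s + r * x)\<^sup>2) (at x)"
    if "s + r * x \<noteq> 0" for x
    by (rule derivative_eq_intros refl that)+
      (use that in \<open>simp add: D_def divide_simps power2_eq_square, simp add: algebra_simps\<close>)
  show "((\<lambda>t. (p + q * X t) / (s + r * X t)) has_real_derivative D / ?e\<^sup>2 * X' t) (at t)"
    using DERIV_chain2[OF N[OF s] d(1)] .
  show "(D / ?e\<^sup>2 * X' t)\<^sup>2 = poly R ((p + q * ?x) / ?e)"
    using eq[OF s] d(3) by (simp add: power_mult_distrib power_divide flip: power_mult)
  \<comment> \<open>The second-order equation cannot be obtained by differentiating the first
    integral in time and dividing by the velocity, which vanishes at turning points. Instead the
    identity \<open>eq\<close> is differentiated in the variable \<open>x\<close>, near the point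
    \<open>X t\<close>.\<close>
  let ?R' = "poly (pderiv R) ((p + q * ?x) / ?e)"
  have 1: "((\<lambda>x. poly R ((p + q * x) / (s + r * x))) has_real_derivative ?R' * (D / ?e\<^sup>2)) (at ?x)"
    by (rule DERIV_chain2[OF poly_DERIV N[OF s]])
  have 2: "((\<lambda>x. D\<^sup>2 / (s + r * x) ^ 4 * poly P x) has_real_derivative
      D\<^sup>2 / ?e ^ 4 * poly (pderiv P) ?x - 4 * r * D\<^sup>2 / ?e ^ 5 * poly P ?x) (at ?x)"
    by (rule derivative_eq_intros poly_DERIV refl | (use s[of t] in simp; fail))+
      (use s[of t] in \<open>simp add: divide_simps, simp add: algebra_simps eval_nat_numeral\<close>)
  have "open {x. s + r * x \<noteq> 0}"
    by (intro open_Collect_neq continuous_intros)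
  then have "((\<lambda>x. poly R ((p + q * x) / (s + r * x))) has_real_derivative
      D\<^sup>2 / ?e ^ 4 * poly (pderiv P) ?x - 4 * r * D\<^sup>2 / ?e ^ 5 * poly P ?x) (at ?x)"
    by (rule has_field_derivative_transform_within_open[OF 2]) (use s eq in auto)
  with 1 have "?R' * (D / ?e\<^sup>2) = D\<^sup>2 / ?e ^ 4 * poly (pderiv P) ?x - 4 * r * D\<^sup>2 / ?e ^ 5 * poly P ?x"
    by (rule DERIV_unique)
  also have "\<dots> = (D / ?e\<^sup>2 * poly (pderiv P) ?x - 4 * r * D / ?e ^ 3 * poly P ?x) * (D / ?e\<^sup>2)"
  proof -
    have "D\<^sup>2 / e ^ 4 * a - 4 * r * D\<^sup>2 / e ^ 5 * b = (D / e\<^sup>2 * a - 4 * r * D / e ^ 3 * b) * (D / e\<^sup>2)"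
      if "e \<noteq> 0" for e a b
      using that by (simp add: divide_simps eval_nat_numeral) (simp add: algebra_simps)
    from this[OF s] show ?thesis .
  qed
  finally have R': "?R' = D / ?e\<^sup>2 * poly (pderiv P) ?x - 4 * r * D / ?e ^ 3 * poly P ?x"
    using s[of t] D by simp
  show "((\<lambda>t. D / (s + r * X t)\<^sup>2 * X' t) has_real_derivative ?R' / 2) (at t)"
    unfolding R' d(3)[symmetric]
    by (rule derivative_eq_intros d(1,2) refl | (use s[of t] in simp; fail))+
      (use s[of t] in \<open>simp add: divide_simps, simp add: algebra_simps eval_nat_numeral\<close>)
qed

section \<open>Periods and complete elliptic integrals\<close>

lemma integral_eq_antiderivative_diff:
  assumes "a \<le> b" "\<And>x. (F has_real_derivative f x) (at x)"
  shows "integral {a..b} f = F b - F a"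
  by (rule integral_unique[OF fundamental_theorem_of_calculus])
    (use assms in \<open>auto simp flip: has_real_derivative_iff_has_vector_derivative
      intro: has_field_derivative_at_within\<close>)

lemma antiderivative_exists:
  fixes f :: "real \<Rightarrow> real"
  assumes "continuous_on UNIV f"
  obtains F where "\<And>x. (F has_real_derivative f x) (at x)"
  using einterval_antiderivative[of "-\<infinity>" "\<infinity>" f] assms that
  by (auto simp: continuous_on_eq_continuous_at has_real_derivative_iff_has_vector_derivative)

lemma antiderivative_shift_diff:
  assumes F: "\<And>x. (F has_real_derivative f x) (at x)" and per: "\<And>x. f (x + L) = f x"
  shows "F (x + L) - F x = F (y + L) - F y"
  by (rule DERIV_isconst_all[of "\<lambda>x. F (x + L) - F x"])
    (auto intro!: derivative_eq_intros F DERIV_shift[THEN iffD1, OF F] simp: per)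

text \<open>The equation \<open>\<theta>' = 1 / g \<theta>\<close> is solved by inverting an antiderivative of \<open>g\<close>.\<close>

lemma periodic_clock:
  fixes g :: "real \<Rightarrow> real"
  assumes cont: "continuous_on UNIV g" and pos: "\<And>x. g x > 0" and per: "\<And>x. g (x + L) = g x"
    and "L > 0"
  defines "T \<equiv> integral {0..L} g"
  obtains \<theta> where "T > 0" "\<theta> 0 = \<theta>0" "\<And>t. (\<theta> has_real_derivative 1 / g (\<theta> t)) (at t)"
    "\<And>t. \<theta> (t + T) = \<theta> t + L"
proof -
  obtain F where F: "\<And>x. (F has_real_derivative g x) (at x)"
    using antiderivative_exists[OF cont] by blast
  define G where "G x = F x - F \<theta>0" for x
  have G: "(G has_real_derivative g x) (at x)" for x
    unfolding G_def[abs_def] by (auto intro!: derivative_eq_intros F)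
  have G_less: "G x < G y" if "x < y" for x y
    using DERIV_pos_imp_increasing[OF that, of G] G pos by blast
  have T: "T = G L - G 0"
    unfolding T_def using \<open>L > 0\<close> by (intro integral_eq_antiderivative_diff G) simp
  with G_less[OF \<open>L > 0\<close>] have "T > 0" by simp
  have G_shift: "G (x + L) = G x + T" for x
    using antiderivative_shift_diff[of G g L x 0, OF G per] T by simp
  have G_nat: "G (x + real n * L) = G x + real n * T" for x n
  proof (induction n)
    case (Suc n)
    have "G (x + real (Suc n) * L) = G (x + real n * L + L)" by (simp add: algebra_simps)
    then show ?case unfolding G_shift Suc by (simp add: algebra_simps)
  qed simp
  have cont_G: "isCont G x" for x using G DERIV_isCont by blast
  \<comment> \<open>\<open>G\<close> gains \<open>T > 0\<close> over each period of
    \<open>g\<close>, so it is unbounded in both directions and hence onto.\<close>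
  have "\<exists>x. G x = y" for y
  proof -
    obtain n where n: "\<bar>y\<bar> < real n * T"
      using reals_Archimedean3[OF \<open>T > 0\<close>] by blast
    have "G \<theta>0 = 0" by (simp add: G_def)
    then have "G (\<theta>0 + real n * L) = real n * T" "G (\<theta>0 - real n * L) = - (real n * T)"
      using G_nat[of \<theta>0 n] G_nat[of "\<theta>0 - real n * L" n] by simp_all
    then show ?thesis
      using IVT[of G "\<theta>0 - real n * L" y "\<theta>0 + real n * L"] n cont_G \<open>L > 0\<close>
      by (fastforce simp: abs_less_iff)
  qed
  then obtain \<theta> where \<theta>: "\<And>y. G (\<theta> y) = y" by metis
  have inj: "x = y" if "G x = G y" for x y
    using G_less[of x y] G_less[of y x] that by (cases x y rule: linorder_cases) auto
  have \<theta>G: "\<theta> (G x) = x" for x using inj \<theta> by blast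
  have "isCont \<theta> (G x)" for x
    by (rule isCont_inverse_function[where d=1]) (use \<theta>G cont_G in auto)
  then have cont_\<theta>: "isCont \<theta> t" for t by (metis \<theta>)
  show ?thesis
  proof (rule that[OF \<open>T > 0\<close>])
    show "\<theta> 0 = \<theta>0" using \<theta>G[of \<theta>0] by (simp add: G_def)
    show "(\<theta> has_real_derivative 1 / g (\<theta> t)) (at t)" for t
      using DERIV_inverse_function[where f=G and g=\<theta> and x=t and a="t - 1" and b="t + 1"] G \<theta> cont_\<theta> pos[of "\<theta> t"]
      by (auto simp: inverse_eq_divide)
    show "\<theta> (t + T) = \<theta> t + L" for t
      by (rule inj) (simp add: \<theta> G_shift)
  qed
qed

text \<open>The velocity of \<open>X\<close> vanishes at the turning points, where the usual time
  integral is singular. The angle has the strictly positive speed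
  \<open>sqrt (poly H (cos \<theta>))\<close>, so it runs through a full turn in time
  \<open>T\<close> without any singularity.\<close>

lemma energy_solution_angle_periodic:
  fixes H :: "real poly"
  assumes X: "energy_solution ([:1, 0, -1:] * H) X X'" and X0: "\<bar>X 0\<bar> \<le> 1"
    and H: "\<And>x. \<bar>x\<bar> \<le> 1 \<Longrightarrow> poly H x > 0"
  defines "T \<equiv> integral {0..2 * pi} (\<lambda>\<psi>. 1 / sqrt (poly H (cos \<psi>)))"
  shows "T > 0" "X (t + T) = X t"
proof -
  have Hc: "poly H (cos \<psi>) > 0" for \<psi> by (simp add: H)
  let ?v = "sqrt (poly H (X 0))"
  have "(X' 0)\<^sup>2 = (1 - (X 0)\<^sup>2) * poly H (X 0)"
    using energy_solutionD(3)[OF X, of 0] by (simp add: algebra_simps power2_eq_square)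
  then have "(X' 0)\<^sup>2 = (sqrt (1 - (X 0)\<^sup>2) * ?v)\<^sup>2"
    using H[OF X0] X0 by (simp add: power_mult_distrib abs_square_le_1)
  then have "X' 0 = - sqrt (1 - (X 0)\<^sup>2) * ?v \<or> X' 0 = sqrt (1 - (X 0)\<^sup>2) * ?v"
    by (auto simp: power2_eq_iff)
  moreover have "cos (arccos (X 0)) = X 0" "sin (arccos (X 0)) = sqrt (1 - (X 0)\<^sup>2)"
    using X0 by (auto simp: sin_arccos abs_le_iff)
  \<comment> \<open>Changing the sign of the angle keeps its cosine and reverses the velocity, so
    one of the two angles matches both initial data.\<close>
  ultimately obtain \<theta>0 where \<theta>0: "X 0 = cos \<theta>0" "X' 0 = - sin \<theta>0 * sqrt (poly H (cos \<theta>0))"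
    by (metis cos_minus mult_minus_left sin_minus minus_minus)
  have "continuous_on UNIV (\<lambda>\<psi>. 1 / sqrt (poly H (cos \<psi>)))"
    using Hc by (intro continuous_intros) (metis less_irrefl real_sqrt_eq_0_iff)
  then obtain \<theta> where \<theta>: "T > 0" "\<theta> 0 = \<theta>0" "\<And>t. \<theta> (t + T) = \<theta> t + 2 * pi"
    and "\<And>t. (\<theta> has_real_derivative 1 / (1 / sqrt (poly H (cos (\<theta> t))))) (at t)"
    by (rule periodic_clock[of "\<lambda>\<psi>. 1 / sqrt (poly H (cos \<psi>))" "2 * pi" \<theta>0, folded T_def])
      (use Hc in simp_all)
  then have \<theta>': "\<And>t. (\<theta> has_real_derivative sqrt (poly H (cos (\<theta> t)))) (at t)"
    by simp
  define Y' where "Y' t = - sin (\<theta> t) * sqrt (poly H (cos (\<theta> t)))" for t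
  have Y: "energy_solution ([:1, 0, -1:] * H) (\<lambda>t. cos (\<theta> t)) Y'"
    unfolding energy_solution_def
  proof (intro allI conjI)
    fix t
    let ?h = "poly H (cos (\<theta> t))"
    have s: "sqrt ?h > 0" "?h > 0" by (simp_all add: Hc)
    show "((\<lambda>t. cos (\<theta> t)) has_real_derivative Y' t) (at t)"
      by (auto intro!: derivative_eq_intros \<theta>' simp: Y'_def)
    have "(sin (\<theta> t))\<^sup>2 = 1 - (cos (\<theta> t))\<^sup>2" by (simp add: sin_squared_eq)
    then show "(Y' t)\<^sup>2 = poly ([:1, 0, -1:] * H) (cos (\<theta> t))"
      using s by (simp add: Y'_def power_mult_distrib) (simp add: power2_eq_square algebra_simps)
    have h: "((\<lambda>t. poly H (cos (\<theta> t))) has_real_derivative poly (pderiv H) (cos (\<theta> t)) * Y' t) (at t)"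
      by (rule DERIV_chain2[OF poly_DERIV]) fact
    have "sqrt ?h * sqrt ?h = ?h" using s by simp
    then have "- (cos (\<theta> t) * sqrt ?h) * sqrt ?h +
        (poly (pderiv H) (cos (\<theta> t)) * Y' t) * (inverse (sqrt ?h) / 2) * (- sin (\<theta> t)) =
        - cos (\<theta> t) * ?h + (sin (\<theta> t))\<^sup>2 * poly (pderiv H) (cos (\<theta> t)) / 2"
      using s by (simp add: Y'_def field_simps power2_eq_square)
    also have "\<dots> = poly (pderiv ([:1, 0, -1:] * H)) (cos (\<theta> t)) / 2"
      unfolding pderiv_mult sin_squared_eq by (simp add: pderiv_pCons field_simps power2_eq_square)
    finally have "- (cos (\<theta> t) * sqrt ?h) * sqrt ?h +
        (poly (pderiv H) (cos (\<theta> t)) * Y' t) * (inverse (sqrt ?h) / 2) * (- sin (\<theta> t)) =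
        poly (pderiv ([:1, 0, -1:] * H)) (cos (\<theta> t)) / 2" .
    moreover have "(Y' has_real_derivative - (cos (\<theta> t) * sqrt ?h) * sqrt ?h +
        (poly (pderiv H) (cos (\<theta> t)) * Y' t) * (inverse (sqrt ?h) / 2) * (- sin (\<theta> t))) (at t)"
      unfolding Y'_def[abs_def]
      by (rule DERIV_cong[OF DERIV_mult[OF _ DERIV_chain2[OF DERIV_real_sqrt[OF s(2)] h]]])
        (auto intro!: derivative_eq_intros \<theta>' simp: Y'_def)
    ultimately show "(Y' has_real_derivative poly (pderiv ([:1, 0, -1:] * H)) (cos (\<theta> t)) / 2) (at t)"
      by (rule subst[where P="\<lambda>d. (Y' has_real_derivative d) (at t)"])
  qed
  have "X t = cos (\<theta> t)" for t
    by (rule energy_solution_unique[OF X Y, of 0]) (simp_all add: \<theta>0 \<theta>(2) Y'_def)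
  then show "X (t + T) = X t" by (simp add: \<theta>(3))
  show "T > 0" by (rule \<theta>(1))
qed

lemma
  assumes k: "k\<^sup>2 < 1" and "c > 0"
  shows integral_cos_ellipticK:
      "integral {0..2 * pi} (\<lambda>\<psi>. 1 / sqrt (c\<^sup>2 * (1 - k\<^sup>2 + k\<^sup>2 * (cos \<psi>)\<^sup>2))) = 4 * ellipticK k / c"
    and integral_half_cos_ellipticK:
      "integral {0..2 * pi} (\<lambda>\<psi>. 1 / sqrt (c\<^sup>2 * (1 - k\<^sup>2 * (1 - cos \<psi>) / 2))) = 4 * ellipticK k / c"
proof -
  define e where "e \<theta> = 1 / sqrt (1 - k\<^sup>2 * (sin \<theta>)\<^sup>2)" for \<theta>
  have pos: "1 - k\<^sup>2 * (sin \<theta>)\<^sup>2 > 0" for \<theta>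
    using mult_left_mono[of "(sin \<theta>)\<^sup>2" 1 "k\<^sup>2"] k by (simp add: abs_square_le_1)
  have "continuous_on UNIV e"
    unfolding e_def[abs_def] by (intro continuous_intros) (use pos in \<open>auto simp: less_imp_neq[symmetric]\<close>)
  then obtain F where F: "\<And>x. (F has_real_derivative e x) (at x)"
    using antiderivative_exists by blast
  have K: "ellipticK k = F (pi / 2) - F 0"
    unfolding ellipticK_def e_def[symmetric] by (rule integral_eq_antiderivative_diff[OF _ F]) simp
  \<comment> \<open>The integrand is symmetric about \<open>pi / 2\<close>, so the quarter integral
    doubles on \<open>{0..pi}\<close>; its period \<open>pi\<close> then gives four quarters for a
    full turn.\<close>
  have "F pi + F (pi - pi) = F (pi / 2) + F (pi - pi / 2)"
    by (rule DERIV_isconst_all[of "\<lambda>x. F x + F (pi - x)"])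
      (auto intro!: derivative_eq_intros F DERIV_chain2[OF F, of "\<lambda>x. pi - x" "-1"] simp: e_def)
  then have K2: "F pi - F 0 = 2 * ellipticK k" by (simp add: K)
  have "F (pi + pi) - F pi = F (0 + pi) - F 0"
    by (rule antiderivative_shift_diff[OF F]) (simp add: e_def)
  then have K4: "F (2 * pi) - F 0 = 4 * ellipticK k" using K2 by simp
  have "1 - k\<^sup>2 + k\<^sup>2 * (cos \<psi>)\<^sup>2 = 1 - k\<^sup>2 * (sin \<psi>)\<^sup>2" for \<psi>
    by (simp add: cos_squared_eq algebra_simps)
  then have "1 / sqrt (c\<^sup>2 * (1 - k\<^sup>2 + k\<^sup>2 * (cos \<psi>)\<^sup>2)) = e \<psi> / c" for \<psi>
    using \<open>c > 0\<close> by (simp add: e_def real_sqrt_mult)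
  then show "integral {0..2 * pi} (\<lambda>\<psi>. 1 / sqrt (c\<^sup>2 * (1 - k\<^sup>2 + k\<^sup>2 * (cos \<psi>)\<^sup>2))) = 4 * ellipticK k / c"
    using integral_eq_antiderivative_diff[of 0 "2 * pi" "\<lambda>x. F x / c" "\<lambda>x. e x / c"] K4
    by (simp add: DERIV_cdivide F flip: diff_divide_distrib)
  have "1 / sqrt (c\<^sup>2 * (1 - k\<^sup>2 * (1 - cos \<psi>) / 2)) = e (\<psi> / 2) / c" for \<psi>
    using \<open>c > 0\<close> cos_double_sin[of "\<psi> / 2"] by (simp add: e_def real_sqrt_mult)
  moreover have "((\<lambda>x. 2 * F (x / 2) / c) has_real_derivative e (x / 2) / c) (at x)" for x
    using \<open>c > 0\<close> by (auto intro!: derivative_eq_intros DERIV_chain2[OF F, of "\<lambda>x. x / 2" "1 / 2"])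
  ultimately show "integral {0..2 * pi} (\<lambda>\<psi>. 1 / sqrt (c\<^sup>2 * (1 - k\<^sup>2 * (1 - cos \<psi>) / 2))) = 4 * ellipticK k / c"
    using \<open>c > 0\<close> integral_eq_antiderivative_diff[of 0 "2 * pi" "\<lambda>x. 2 * F (x / 2) / c" "\<lambda>x. e (x / 2) / c"] K2
    by (simp flip: diff_divide_distrib right_diff_distrib)
qed

section \<open>Closed formulas for the periods of a quartic oscillator\<close>

lemma moebius_inj:
  fixes p q r s x y :: real
  assumes "s + r * x \<noteq> 0" "s + r * y \<noteq> 0" "q * s - p * r \<noteq> 0"
    and eq: "(p + q * x) / (s + r * x) = (p + q * y) / (s + r * y)"
  shows "x = y"
proof -
  have "(p + q * x) * (s + r * y) = (p + q * y) * (s + r * x)"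
    using eq assms(1,2) by (simp add: frac_eq_eq)
  then have "(q * s - p * r) * (x - y) = 0" by (simp add: algebra_simps)
  with assms(3) show ?thesis by simp
qed

text \<open>The times \<open>s\<close> and \<open>t\<close> come in no particular order, hence the
  argument by connectedness of the range.\<close>

lemma energy_solution_ivt:
  assumes "energy_solution R X X'" "X s \<le> y" "y \<le> X t"
  obtains u where "X u = y"
proof -
  have "connected (range X)"
    by (rule connected_continuous_image[OF energy_solution_cont[OF assms(1)] connected_UNIV])
  then have "y \<in> range X"
    using assms(2,3) unfolding connected_iff_interval by blast
  with that show ?thesis by blast
qed

text \<open>\<open>A\<close> and \<open>B\<close> are the distances of \<beta> and \<alpha> to the
  non-real roots. The map is \<open>y = (E - F) / (E + F)\<close> with
  \<open>E = (\<beta> - x) * B\<close> and \<open>F = (x - \<alpha>) * A\<close>, so \<alpha> goes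
  to 1 and \<beta> to -1. The quadratic factor must become an expression symmetric in
  \<open>E\<close> and \<open>F\<close>, hence even in \<open>y\<close>: its values at \<alpha> and
  \<beta> dictate the weights, and the coefficient of \<open>E * F\<close> dictates
  \<open>k\<close>.\<close>

lemma period_conjugate_roots:
  fixes P :: "real poly"
  assumes X: "energy_solution P X X'"
    and P: "\<And>x. poly P x = - 1/4 * (x - \<alpha>) * (x - \<beta>) * (x\<^sup>2 + b * x + c)"
    and "\<alpha> < \<beta>" and disc: "b\<^sup>2 < 4 * c"
    and A: "A > 0" "A\<^sup>2 = \<beta>\<^sup>2 + b * \<beta> + c" and B: "B > 0" "B\<^sup>2 = \<alpha>\<^sup>2 + b * \<alpha> + c"
  defines "k \<equiv> sqrt (((\<beta> - \<alpha>)\<^sup>2 - (A - B)\<^sup>2) / (4 * A * B))"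
  defines "T \<equiv> 8 * ellipticK k / sqrt (A * B)"
  shows "T > 0" "X (t + T) = X t"
proof -
  have Q: "x\<^sup>2 + b * x + c > 0" for x
    using disc zero_le_power2[of "x + b / 2"] by (simp add: power2_eq_square field_simps)
  have X_mem: "\<alpha> \<le> X t \<and> X t \<le> \<beta>" for t
  proof -
    have "0 \<le> - 1/4 * (X t - \<alpha>) * (X t - \<beta>) * ((X t)\<^sup>2 + b * X t + c)"
      unfolding P[symmetric] energy_solutionD(3)[OF X, symmetric] by simp
    then have "(X t - \<alpha>) * (X t - \<beta>) \<le> 0"
      using Q[of "X t"] by (simp add: mult_le_0_iff)
    then show ?thesis using \<open>\<alpha> < \<beta>\<close> by (auto simp: mult_le_0_iff)
  qed
  \<comment> \<open>For a complex root \<open>z\<close> of the quadratic, \<open>w\<close> is the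
    real part of (\<alpha> - z)(\<beta> - conj z), a number of modulus \<open>A * B\<close> with
    nonzero imaginary part. Since \<open>k\<^sup>2 = (A * B - w) / (2 * A * B)\<close>, the bound on
    \<open>w\<close> places \<open>k\<^sup>2\<close> strictly between 0 and 1.\<close>
  define w where "w = c + b * (\<alpha> + \<beta>) / 2 + \<alpha> * \<beta>"
  have sum: "A\<^sup>2 + B\<^sup>2 = (\<beta> - \<alpha>)\<^sup>2 + 2 * w"
    unfolding A B w_def by (simp add: field_simps power2_eq_square)
  have "(A * B)\<^sup>2 - w\<^sup>2 = (c - b\<^sup>2 / 4) * (\<beta> - \<alpha>)\<^sup>2"
    unfolding power_mult_distrib A B w_def by (simp add: field_simps power2_eq_square)
  also have "\<dots> > 0" using disc \<open>\<alpha> < \<beta>\<close> by simp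
  finally have "\<bar>w\<bar>\<^sup>2 < (A * B)\<^sup>2" by simp
  then have "\<bar>w\<bar> < A * B"
    by (rule power2_less_imp_less) (use A(1) B(1) in simp)
  then have le: "(A - B)\<^sup>2 \<le> (\<beta> - \<alpha>)\<^sup>2" and less: "(\<beta> - \<alpha>)\<^sup>2 - (A - B)\<^sup>2 < 4 * A * B"
    using sum by (simp_all add: power2_eq_square algebra_simps)
  have AB: "A * B > 0" using A(1) B(1) by simp
  have k2: "k\<^sup>2 = ((\<beta> - \<alpha>)\<^sup>2 - (A - B)\<^sup>2) / (4 * A * B)"
    unfolding k_def using le AB by simp
  have kAB: "k\<^sup>2 * (4 * A * B) = (\<beta> - \<alpha>)\<^sup>2 - (A - B)\<^sup>2"
    unfolding k2 using A(1) B(1) by simp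
  have k1: "k\<^sup>2 < 1" unfolding k2 using less A(1) B(1) by (simp add: divide_less_eq)
  define H where "H = smult (A * B / 4) [:1 - k\<^sup>2, 0, k\<^sup>2:]"
  define p q s r where "p = \<beta> * B + \<alpha> * A" and "q = - (A + B)" and "s = \<beta> * B - \<alpha> * A" and "r = A - B"
  let ?D = "q * s - p * r"
  have D: "?D = - 2 * A * B * (\<beta> - \<alpha>)"
    unfolding p_def q_def r_def s_def by (simp add: algebra_simps)
  have den: "s + r * x = (\<beta> - x) * B + (x - \<alpha>) * A" for x
    unfolding s_def r_def by (simp add: algebra_simps)
  have num: "p + q * x = (\<beta> - x) * B - (x - \<alpha>) * A" for x
    unfolding p_def q_def by (simp add: algebra_simps)
  have den_pos: "s + r * X t > 0" for t
  proof (cases "X t = \<alpha>")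
    case True
    then show ?thesis unfolding den using B(1) \<open>\<alpha> < \<beta>\<close> by simp
  next
    case False
    then show ?thesis unfolding den using A(1) B(1) X_mem[of t]
      by (intro add_nonneg_pos) auto
  qed
  have eq: "poly ([:1, 0, -1:] * H) ((p + q * x) / (s + r * x)) = ?D\<^sup>2 / (s + r * x) ^ 4 * poly P x"
    if nz: "s + r * x \<noteq> 0" for x
  proof -
    define E F where "E = (\<beta> - x) * B" and "F = (x - \<alpha>) * A"
    have e: "s + r * x = E + F" "p + q * x = E - F" by (simp_all add: den num E_def F_def)
    have "(1 - k\<^sup>2) * (E + F)\<^sup>2 + k\<^sup>2 * (E - F)\<^sup>2 = (E + F)\<^sup>2 - k\<^sup>2 * (4 * A * B) * ((\<beta> - x) * (x - \<alpha>))"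
      by (simp add: E_def F_def algebra_simps power2_eq_square)
    also have "\<dots> = (\<beta> - x)\<^sup>2 * B\<^sup>2 + (x - \<alpha>)\<^sup>2 * A\<^sup>2 + (A\<^sup>2 + B\<^sup>2 - (\<beta> - \<alpha>)\<^sup>2) * ((\<beta> - x) * (x - \<alpha>))"
      unfolding kAB E_def F_def by (simp add: algebra_simps power2_eq_square)
    also have "\<dots> = (\<beta> - \<alpha>)\<^sup>2 * (x\<^sup>2 + b * x + c)"
      unfolding A B by (simp add: algebra_simps power2_eq_square)
    finally have key: "(1 - k\<^sup>2) * (E + F)\<^sup>2 + k\<^sup>2 * (E - F)\<^sup>2 = (\<beta> - \<alpha>)\<^sup>2 * (x\<^sup>2 + b * x + c)" .
    have gen: "(1 - (n / d)\<^sup>2) * (C * (1 - k\<^sup>2 + k\<^sup>2 * (n / d)\<^sup>2)) =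
        (d\<^sup>2 - n\<^sup>2) * C * ((1 - k\<^sup>2) * d\<^sup>2 + k\<^sup>2 * n\<^sup>2) / d ^ 4" if "d \<noteq> 0" for n d C :: real
      using that by (simp add: field_simps power2_eq_square eval_nat_numeral)
    have "poly ([:1, 0, -1:] * H) y = (1 - y\<^sup>2) * (A * B / 4 * (1 - k\<^sup>2 + k\<^sup>2 * y\<^sup>2))" for y
      unfolding H_def poly_mult poly_smult by (simp add: power2_eq_square algebra_simps)
    then have "poly ([:1, 0, -1:] * H) ((p + q * x) / (s + r * x)) =
        (1 - ((E - F) / (E + F))\<^sup>2) * (A * B / 4 * (1 - k\<^sup>2 + k\<^sup>2 * ((E - F) / (E + F))\<^sup>2))"
      unfolding e by blast
    also have "\<dots> = ((E + F)\<^sup>2 - (E - F)\<^sup>2) * (A * B / 4) * ((\<beta> - \<alpha>)\<^sup>2 * (x\<^sup>2 + b * x + c)) / (E + F) ^ 4"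
      using gen[of "E + F" "E - F" "A * B / 4"] nz unfolding e key by blast
    also have "((E + F)\<^sup>2 - (E - F)\<^sup>2) * (A * B / 4) * ((\<beta> - \<alpha>)\<^sup>2 * (x\<^sup>2 + b * x + c)) = ?D\<^sup>2 * poly P x"
      unfolding D P E_def F_def by (simp add: field_simps power2_eq_square)
    finally show ?thesis unfolding e by simp
  qed
  have D_nz: "?D \<noteq> 0" unfolding D using A(1) B(1) \<open>\<alpha> < \<beta>\<close> by simp
  let ?Y = "\<lambda>t. (p + q * X t) / (s + r * X t)"
  have Y: "energy_solution ([:1, 0, -1:] * H) ?Y (\<lambda>t. ?D / (s + r * X t)\<^sup>2 * X' t)"
    using energy_solution_moebius[OF X D_nz _ eq] den_pos by (metis less_irrefl)
  have Y0: "\<bar>?Y 0\<bar> \<le> 1"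
  proof -
    have "(\<beta> - X 0) * B \<ge> 0" "(X 0 - \<alpha>) * A \<ge> 0" using A(1) B(1) X_mem[of 0] by simp_all
    then show ?thesis
      using den_pos[of 0] unfolding abs_divide num den by (simp add: divide_le_eq)
  qed
  have H_eq: "poly H x = (sqrt (A * B) / 2)\<^sup>2 * (1 - k\<^sup>2 + k\<^sup>2 * x\<^sup>2)" for x
    using AB by (simp add: H_def power_divide power2_eq_square field_simps)
  have "poly H x > 0" for x
    unfolding H_eq using AB k1 by (intro mult_pos_pos) (auto intro: add_pos_nonneg)
  note per = energy_solution_angle_periodic[OF Y Y0 this]
  have "T = integral {0..2 * pi} (\<lambda>\<psi>. 1 / sqrt (poly H (cos \<psi>)))"
    unfolding H_eq T_def using integral_cos_ellipticK[OF k1, of "sqrt (A * B) / 2"] AB by simp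
  note per = per[folded this]
  show "T > 0" using per(1) by simp
  show "X (t + T) = X t"
    by (rule moebius_inj[OF _ _ D_nz per(2)]) (use den_pos in \<open>auto simp: less_imp_neq[symmetric]\<close>)
qed

text \<open>The map has its pole at \<open>d\<close> and sends \<alpha> to -1 and \<beta> to 1, so
  the quartic becomes a cubic and \<open>H\<close> is linear with its zero at the image of
  \<open>c\<close>. If \<open>c = d\<close>, then \<open>k = 0\<close> and \<open>H\<close> is
  constant; the lemma thus also covers a double root outside the interval of motion.\<close>

lemma period_roots_below:
  fixes P :: "real poly"
  assumes X: "energy_solution P X X'"
    and P: "\<And>x. poly P x = - 1/4 * (x - \<alpha>) * (x - \<beta>) * (x - c) * (x - d)"
    and ord: "d \<le> c" "c < \<alpha>" "\<alpha> < \<beta>" and X0: "\<alpha> \<le> X 0"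
  defines "k \<equiv> sqrt ((\<beta> - \<alpha>) * (c - d) / ((\<beta> - c) * (\<alpha> - d)))"
  defines "T \<equiv> 8 * ellipticK k / sqrt ((\<beta> - c) * (\<alpha> - d))"
  shows "T > 0" "X (t + T) = X t"
proof -
  have P_nonneg: "0 \<le> - 1/4 * (X t - \<alpha>) * (X t - \<beta>) * (X t - c) * (X t - d)" for t
    unfolding P[symmetric] energy_solutionD(3)[OF X, symmetric] by simp
  \<comment> \<open>The potential is negative between \<open>c\<close> and \<alpha>, so the midpoint
    is a barrier that keeps the motion on the side of \<alpha> where it starts.\<close>
  have not_mid: "X t \<noteq> (c + \<alpha>) / 2" for t
  proof
    assume t: "X t = (c + \<alpha>) / 2"
    have "(X t - \<alpha>) * (X t - \<beta>) > 0" "(X t - c) * (X t - d) > 0"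
      using ord by (auto simp: t intro: mult_neg_neg)
    then have "((X t - \<alpha>) * (X t - \<beta>)) * ((X t - c) * (X t - d)) > 0" by (rule mult_pos_pos)
    with P_nonneg[of t] show False by (simp add: mult.assoc)
  qed
  have X_mem: "\<alpha> \<le> X t \<and> X t \<le> \<beta>" for t
  proof -
    have "X t > (c + \<alpha>) / 2"
    proof (rule ccontr)
      assume "\<not> ?thesis"
      then have "X t \<le> (c + \<alpha>) / 2" "(c + \<alpha>) / 2 \<le> X 0" using X0 ord by simp_all
      then obtain u where "X u = (c + \<alpha>) / 2" by (rule energy_solution_ivt[OF X])
      with not_mid show False by blast
    qed
    then have "(X t - c) * (X t - d) > 0" using ord by simp
    moreover have "((X t - \<alpha>) * (X t - \<beta>)) * ((X t - c) * (X t - d)) \<le> 0"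
      using P_nonneg[of t] by (simp add: mult.assoc)
    ultimately have "(X t - \<alpha>) * (X t - \<beta>) \<le> 0"
      by (metis mult_pos_pos not_le)
    then show ?thesis using ord by (auto simp: mult_le_0_iff)
  qed
  define M where "M = (\<beta> - c) * (\<alpha> - d)"
  have M: "M > 0" using ord by (simp add: M_def)
  have k2: "k\<^sup>2 = (\<beta> - \<alpha>) * (c - d) / M"
    unfolding k_def M_def[symmetric] using ord M by simp
  \<comment> \<open>The difference of the two sides factors as
    \<open>(\<beta> - d) * (\<alpha> - c)\<close>.\<close>
  have "(\<beta> - \<alpha>) * (c - d) < M"
    using mult_pos_pos[of "\<beta> - d" "\<alpha> - c"] ord by (simp add: M_def algebra_simps)
  then have k1: "k\<^sup>2 < 1" unfolding k2 using M by simp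
  define H where "H = smult (M / 4) [:1 - k\<^sup>2 / 2, k\<^sup>2 / 2:]"
  define p q s r where "p = - (\<beta> - \<alpha>) * d - 2 * (\<alpha> - d) * \<beta>" and "q = (\<beta> - \<alpha>) + 2 * (\<alpha> - d)"
    and "s = - (\<beta> - \<alpha>) * d" and "r = \<beta> - \<alpha>"
  let ?D = "q * s - p * r"
  have D: "?D = 2 * (\<alpha> - d) * (\<beta> - \<alpha>) * (\<beta> - d)"
    unfolding p_def q_def r_def s_def by (simp add: algebra_simps)
  have den: "s + r * x = (\<beta> - \<alpha>) * (x - d)" for x
    unfolding s_def r_def by (simp add: algebra_simps)
  have num: "p + q * x = (\<beta> - \<alpha>) * (x - d) - 2 * (\<alpha> - d) * (\<beta> - x)" for x
    unfolding p_def q_def by (simp add: algebra_simps)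
  have num': "(s + r * x) + (p + q * x) = 2 * (\<beta> - d) * (x - \<alpha>)" for x
    unfolding p_def q_def r_def s_def by (simp add: algebra_simps)
  have den_pos: "s + r * X t > 0" for t
    unfolding den using X_mem[of t] ord by simp
  have eq: "poly ([:1, 0, -1:] * H) ((p + q * x) / (s + r * x)) = ?D\<^sup>2 / (s + r * x) ^ 4 * poly P x"
    if nz: "s + r * x \<noteq> 0" for x
  proof -
    let ?e = "s + r * x" and ?y = "(p + q * x) / (s + r * x)"
    have xd: "x - d \<noteq> 0" using nz den by auto
    have m: "1 - ?y = 2 * (\<alpha> - d) * (\<beta> - x) / ?e"
      using nz by (simp add: diff_divide_eq_iff divide_simps num den)
    have pl: "1 + ?y = 2 * (\<beta> - d) * (x - \<alpha>) / ?e"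
      unfolding num'[symmetric] add_divide_distrib[of "s + r * x"] using nz by simp
    have H1: "M * (1 - k\<^sup>2 * (1 - ?y) / 2) = (\<alpha> - d) * (\<beta> - d) * (x - c) / (x - d)"
    proof -
      have "M * (1 - k\<^sup>2 * (1 - ?y) / 2) = M - (M * k\<^sup>2) * (1 - ?y) / 2" by (simp add: algebra_simps)
      also have "M * k\<^sup>2 = (\<beta> - \<alpha>) * (c - d)" using M by (simp add: k2)
      also have "M - (\<beta> - \<alpha>) * (c - d) * (1 - ?y) / 2 = M - (c - d) * (\<alpha> - d) * (\<beta> - x) / (x - d)"
      proof -
        have "g * a * (2 * b * w / (g * v)) / 2 = a * b * w / v" if "g \<noteq> 0" "v \<noteq> 0"
          for g a b w v :: real
          using that by simp
        note cancel = this
        have "(\<beta> - \<alpha>) * (c - d) * (1 - ?y) / 2 = (c - d) * (\<alpha> - d) * (\<beta> - x) / (x - d)"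
          unfolding m unfolding den by (rule cancel) (use xd ord in auto)
        then show ?thesis by (simp only:)
      qed
      also have "\<dots> = (\<alpha> - d) * (\<beta> - d) * (x - c) / (x - d)"
        using xd by (simp add: M_def field_simps)
      finally show ?thesis .
    qed
    have H2: "poly ([:1, 0, -1:] * H) y = (1 - y) * (1 + y) * (M * (1 - k\<^sup>2 * (1 - y) / 2)) / 4" for y
      unfolding H_def poly_mult poly_smult by (simp add: field_simps)
    have "poly ([:1, 0, -1:] * H) ?y = (2 * (\<alpha> - d) * (\<beta> - x) / ?e) * (2 * (\<beta> - d) * (x - \<alpha>) / ?e)
        * ((\<alpha> - d) * (\<beta> - d) * (x - c) / (x - d)) / 4"
      unfolding H2 H1 unfolding m pl ..
    also have "\<dots> = ?D\<^sup>2 / ?e ^ 4 * poly P x"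
    proof -
      have g: "2 * u * b / (g * v) * (2 * w * a / (g * v)) * (u * w * C / v) / 4 =
          (2 * u * g * w)\<^sup>2 / (g * v) ^ 4 * (1 / 4 * a * b * C * v)"
        if "g \<noteq> 0" "v \<noteq> 0" for u b g v w a C :: real
        using that by (simp add: divide_simps power2_eq_square eval_nat_numeral)
      have P': "poly P x = 1 / 4 * (x - \<alpha>) * (\<beta> - x) * (x - c) * (x - d)"
        unfolding P by (simp add: field_simps)
      show ?thesis
        unfolding P' D den by (rule g) (use xd ord in auto)
    qed
    finally show ?thesis .
  qed
  have D_nz: "?D \<noteq> 0" unfolding D using ord by simp
  let ?Y = "\<lambda>t. (p + q * X t) / (s + r * X t)"
  have Y: "energy_solution ([:1, 0, -1:] * H) ?Y (\<lambda>t. ?D / (s + r * X t)\<^sup>2 * X' t)"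
    using energy_solution_moebius[OF X D_nz _ eq] den_pos by (metis less_irrefl)
  have Y0: "\<bar>?Y 0\<bar> \<le> 1"
  proof -
    have "p + q * X 0 \<le> s + r * X 0" unfolding num den using X_mem[of 0] ord by simp
    moreover have "0 \<le> (s + r * X 0) + (p + q * X 0)" unfolding num' using X_mem[of 0] ord by simp
    ultimately show ?thesis
      using den_pos[of 0] by (simp add: abs_divide divide_le_eq abs_le_iff)
  qed
  have H_eq: "poly H x = (sqrt M / 2)\<^sup>2 * (1 - k\<^sup>2 * (1 - x) / 2)" for x
    using M by (simp add: H_def power_divide field_simps)
  have "poly H x > 0" if "\<bar>x\<bar> \<le> 1" for x
  proof -
    have "k\<^sup>2 * ((1 - x) / 2) \<le> k\<^sup>2 * 1" using that by (intro mult_left_mono) auto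
    then show ?thesis unfolding H_eq using M k1 by (intro mult_pos_pos) auto
  qed
  note per = energy_solution_angle_periodic[OF Y Y0 this]
  have "T = integral {0..2 * pi} (\<lambda>\<psi>. 1 / sqrt (poly H (cos \<psi>)))"
    unfolding H_eq T_def M_def[symmetric] using integral_half_cos_ellipticK[OF k1, of "sqrt M / 2"] M by simp
  note per = per[folded this]
  show "T > 0" using per(1) by simp
  show "X (t + T) = X t"
    by (rule moebius_inj[OF _ _ D_nz per(2)]) (use den_pos in \<open>auto simp: less_imp_neq[symmetric]\<close>)
qed

lemma energy_solution_uminus:
  assumes "energy_solution P X X'"
  shows "energy_solution (pcompose P [:0, -1:]) (\<lambda>t. - X t) (\<lambda>t. - X' t)"
  using energy_solution_moebius[OF assms, of "-1" 1 0 0 "pcompose P [:0, -1:]"] by (simp add: poly_pcompose)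

text \<open>The reflection \<open>x \<mapsto> - x\<close> moves the two outer roots below the
  interval of motion and exchanges its ends.\<close>

lemma period_roots_above:
  fixes P :: "real poly"
  assumes X: "energy_solution P X X'"
    and P: "\<And>x. poly P x = - 1/4 * (x - \<alpha>) * (x - \<beta>) * (x - c) * (x - d)"
    and ord: "\<alpha> < \<beta>" "\<beta> < c" "c \<le> d" and X0: "X 0 \<le> \<beta>"
  defines "k \<equiv> sqrt ((\<beta> - \<alpha>) * (d - c) / ((c - \<alpha>) * (d - \<beta>)))"
  defines "T \<equiv> 8 * ellipticK k / sqrt ((c - \<alpha>) * (d - \<beta>))"
  shows "T > 0" "X (t + T) = X t"
  using period_roots_below[OF energy_solution_uminus[OF X], of "- \<beta>" "- \<alpha>" "- c" "- d"] ord X0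
  by (simp_all add: poly_pcompose P k_def T_def algebra_simps)

section \<open>Non-periodic motions in the presence of a double root\<close>

lemma periodic_bounds_attained:
  fixes f :: "real \<Rightarrow> real"
  assumes "continuous_on UNIV f" and per: "\<And>t. f (t + T) = f t" and "T \<noteq> 0"
  obtains u v where "\<And>t. f u \<le> f t" "\<And>t. f t \<le> f v"
proof -
  have per': "f (t + \<bar>T\<bar>) = f t" for t
    using per[of t] per[of "t - T"] by (cases "T \<ge> 0") simp_all
  interpret periodic_fun_simple f "\<bar>T\<bar>" by standard (rule per')
  have f_red: "\<exists>s\<in>{0..\<bar>T\<bar>}. f t = f s" for t
  proof
    let ?n = "\<lfloor>t / \<bar>T\<bar>\<rfloor>"
    show "f t = f (t - of_int ?n * \<bar>T\<bar>)" by (simp add: minus_of_int)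
    show "t - of_int ?n * \<bar>T\<bar> \<in> {0..\<bar>T\<bar>}"
      using of_int_floor_le[of "t / \<bar>T\<bar>"] floor_correct[of "t / \<bar>T\<bar>"] \<open>T \<noteq> 0\<close>
      by (simp add: pos_le_divide_eq pos_divide_less_eq algebra_simps del: of_int_floor_le)
  qed
  have c: "continuous_on {0..\<bar>T\<bar>} f" "compact {0..\<bar>T\<bar>}" "{0..\<bar>T\<bar>} \<noteq> {}"
    using assms(1) by (auto intro: continuous_on_subset)
  obtain u v where "\<forall>t\<in>{0..\<bar>T\<bar>}. f u \<le> f t" "\<forall>t\<in>{0..\<bar>T\<bar>}. f t \<le> f v"
    using continuous_attains_inf[OF c(2,3,1)] continuous_attains_sup[OF c(2,3,1)] by blast
  with f_red show ?thesis by (metis that)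
qed

text \<open>A periodic solution attains its extreme values at simple roots of the potential, and it cannot
  cross the double root lying between them.\<close>

lemma energy_solution_homoclinic_not_periodic:
  fixes P :: "real poly"
  assumes X: "energy_solution P X X'"
    and P: "\<And>x. poly P x = - 1/4 * (x - r)\<^sup>2 * (x - a) * (x - b)" and ord: "a \<le> r" "r \<le> b"
    and per: "\<And>t. X (t + T) = X t" "T \<noteq> 0"
  shows "poly P (X 0) = 0 \<and> poly (pderiv P) (X 0) = 0"
proof (rule ccontr)
  assume no: "\<not> ?thesis"
  have simple: "\<not> (poly P (X t) = 0 \<and> poly (pderiv P) (X t) = 0)" for t
    using energy_solution_at_double_root[OF X, of t 0] no by metis
  note d = energy_solutionD[OF X]
  have "((\<lambda>x. - 1/4 * (x - r)\<^sup>2 * (x - a) * (x - b)) has_real_derivative 0) (at r)"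
    by (auto intro!: derivative_eq_intros)
  moreover have "poly P = (\<lambda>x. - 1/4 * (x - r)\<^sup>2 * (x - a) * (x - b))" using P by auto
  ultimately have r: "poly P r = 0" "poly (pderiv P) r = 0"
    using DERIV_unique[OF poly_DERIV[of P r]] P by auto
  obtain u v where uv: "\<And>t. X u \<le> X t" "\<And>t. X t \<le> X v"
    using periodic_bounds_attained[OF energy_solution_cont[OF X] per] by blast
  have "X' u = 0" by (rule DERIV_local_min[OF d(1), of 1]) (use uv in auto)
  moreover have "X' v = 0" by (rule DERIV_local_max[OF d(1), of 1]) (use uv in auto)
  ultimately have root: "poly P (X u) = 0" "poly P (X v) = 0" using d(3)[of u] d(3)[of v] by simp_all
  have "X u \<noteq> X v"
  proof
    assume "X u = X v"
    then have const: "X = (\<lambda>t. X 0)" using uv by (metis order_antisym)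
    then have "X' t = 0" for t using d(1)[of t] by (metis DERIV_const DERIV_unique)
    then have "X' = (\<lambda>t. 0)" by auto
    then have "poly (pderiv P) (X u) / 2 = 0" using d(2)[of u] by (metis DERIV_const DERIV_unique)
    with root simple show False by auto
  qed
  \<comment> \<open>An extreme value equal to \<open>r\<close> would make the motion rest at the
    equilibrium \<open>r\<close>. The cases \<open>r = a\<close> and \<open>r = b\<close> of a
    triple root are included.\<close>
  moreover have "X u \<in> {a, b}" "X v \<in> {a, b}"
    using root simple[of u] simple[of v] r by (auto simp: P)
  ultimately have "X u \<le> r" "r \<le> X v" using ord uv(1)[of v] by auto
  then obtain t where "X t = r" by (rule energy_solution_ivt[OF X])
  with simple r show False by auto
qed

section \<open>Discriminant and multiple roots\<close>

text \<open>\<open>complex_roots\<close> lists the roots in an arbitrary order. The product is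
  invariant under adjacent transpositions, and these suffice to bring any enumeration into the order
  \<open>a, b, c, d\<close>, one position at a time.\<close>

lemma prod_diff_squares_4:
  fixes a b c d :: "'a::comm_ring_1"
  assumes "mset rs = {#a, b, c, d#}"
  shows "(\<Prod>j<length rs. \<Prod>i<j. (rs ! i - rs ! j)\<^sup>2) =
    (a - b)\<^sup>2 * (a - c)\<^sup>2 * (a - d)\<^sup>2 * (b - c)\<^sup>2 * (b - d)\<^sup>2 * (c - d)\<^sup>2"
proof -
  define V where "V w x y z = (w - x)\<^sup>2 * (w - y)\<^sup>2 * (w - z)\<^sup>2 * (x - y)\<^sup>2 * (x - z)\<^sup>2 * (y - z)\<^sup>2"
    for w x y z :: 'a
  have swap: "V x w y z = V w x y z" "V w y x z = V w x y z" "V w x z y = V w x y z" for w x y z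
    by (simp_all add: V_def power2_commute mult_ac)
  have V2: "V p q y z = V p q u v" if "{#y, z#} = {#u, v#}" for p q y z u v
    using that unfolding add_eq_conv_diff[of y] by (auto simp: swap split: if_splits)
  have V3: "V p x y z = V p t u v" if eq: "{#x, y, z#} = {#t, u, v#}" for p x y z t u v
  proof -
    have "x \<in># {#t, u, v#}" unfolding eq[symmetric] by simp
    then consider "x = t" | "x = u" | "x = v" by auto
    then show ?thesis
    proof cases
      case 1
      with eq show ?thesis using V2[of y z u v p t] by simp
    next
      case 2
      with eq have "{#y, z#} = {#t, v#}" by (simp add: add_mset_commute[of t u])
      with 2 show ?thesis using V2[of y z t v p u] swap by metis
    next
      case 3
      with eq have "{#y, z#} = {#t, u#}" by (simp add: add_mset_commute[of u v] add_mset_commute[of t v])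
      with 3 show ?thesis using V2[of y z t u p v] swap by metis
    qed
  qed
  have "size (mset rs) = 4" unfolding assms by simp
  then have "length rs = Suc (Suc (Suc (Suc 0)))" by simp
  then obtain w x y z where rs: "rs = [w, x, y, z]"
    by (auto simp: length_Suc_conv)
  have "(\<Prod>j<length rs. \<Prod>i<j. (rs ! i - rs ! j)\<^sup>2) = V w x y z"
    unfolding rs V_def by (simp add: prod.lessThan_Suc mult_ac)
  also have "\<dots> = V a b c d"
  proof -
    have eq: "{#w, x, y, z#} = {#a, b, c, d#}" using assms rs by simp
    then have "w \<in># {#a, b, c, d#}" by (metis union_single_eq_member)
    then consider "w = a" | "w = b" | "w = c" | "w = d" by auto
    then show ?thesis
    proof cases
      case 1
      with eq show ?thesis using V3[of x y z b c d a] by simp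
    next
      case 2
      with eq have "{#x, y, z#} = {#a, c, d#}" by (simp add: add_mset_commute[of a b])
      with 2 show ?thesis using V3[of x y z a c d b] swap by metis
    next
      case 3
      with eq have "{#x, y, z#} = {#a, b, d#}" by (simp add: add_mset_commute[of b c] add_mset_commute[of a c])
      with 3 show ?thesis using V3[of x y z a b d c] swap by metis
    next
      case 4
      with eq have "{#x, y, z#} = {#a, b, c#}"
        by (simp add: add_mset_commute[of c d] add_mset_commute[of b d] add_mset_commute[of a d])
      with 4 show ?thesis using V3[of x y z a b c d] swap by metis
    qed
  qed
  finally show ?thesis by (simp add: V_def)
qed

text \<open>With \<open>z\<close> and \<open>w\<close> the complex roots of the quadratic factor,
  the differences between them and \<alpha> or \<beta> combine into values of that factor, and (z -
  w)^2 is its own discriminant. For nonzero \<open>l\<close> and away from multiple roots the sign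
  is therefore that of \<open>b\<^sup>2 - 4 * c\<close>.\<close>

lemma discriminant_quartic:
  fixes \<alpha> \<beta> b c l :: real
  assumes "P = smult l ([:-\<alpha>, 1:] * [:-\<beta>, 1:] * [:c, b, 1:])" "l \<noteq> 0"
  shows "discriminant P =
    l ^ 6 * ((\<alpha> - \<beta>)\<^sup>2 * (\<alpha>\<^sup>2 + b * \<alpha> + c)\<^sup>2 * (\<beta>\<^sup>2 + b * \<beta> + c)\<^sup>2 * (b\<^sup>2 - 4 * c))"
proof -
  let ?o = complex_of_real
  define s where "s = csqrt (?o (b\<^sup>2 - 4 * c))"
  have s2: "s\<^sup>2 = ?o (b\<^sup>2 - 4 * c)" by (simp add: s_def)
  define z w where "z = (- ?o b + s) / 2" and "w = (- ?o b - s) / 2"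
  have zw: "z + w = - ?o b" "z * w = ?o c" "(z - w)\<^sup>2 = ?o (b\<^sup>2 - 4 * c)"
    using s2 by (simp_all add: z_def w_def field_simps power2_eq_square)
  have vals: "(?o x - z) * (?o x - w) = ?o (x\<^sup>2 + b * x + c)" for x
  proof -
    have "(?o x - z) * (?o x - w) = ?o x * ?o x - (z + w) * ?o x + z * w" by (simp add: algebra_simps)
    then show ?thesis unfolding zw by (simp add: power2_eq_square)
  qed
  have bc: "?o b = - (z + w)" "?o c = z * w" by (simp_all add: zw(1,2))
  have "map_poly ?o P = smult (?o l) ([:- ?o \<alpha>, 1:] * [:- ?o \<beta>, 1:] * ([:-z, 1:] * [:-w, 1:]))"
    unfolding assms(1) by (simp add: map_poly_pCons bc algebra_simps)
  then have "proots (map_poly ?o P) = {#?o \<alpha>, ?o \<beta>, z, w#}"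
    using assms(2) by (simp add: proots_mult del: mult_pCons_left mult_pCons_right)
  then have "mset (complex_roots P) = {#?o \<alpha>, ?o \<beta>, z, w#}"
    unfolding complex_roots_def by (metis (mono_tags, lifting) ex_mset someI_ex)
  note prod_diff_squares_4[OF this]
  also have "(?o \<alpha> - ?o \<beta>)\<^sup>2 * (?o \<alpha> - z)\<^sup>2 * (?o \<alpha> - w)\<^sup>2 * (?o \<beta> - z)\<^sup>2 * (?o \<beta> - w)\<^sup>2 * (z - w)\<^sup>2 =
      (?o \<alpha> - ?o \<beta>)\<^sup>2 * ((?o \<alpha> - z) * (?o \<alpha> - w))\<^sup>2 * ((?o \<beta> - z) * (?o \<beta> - w))\<^sup>2 * (z - w)\<^sup>2"
    by (simp add: power_mult_distrib)
  also have "\<dots> = ?o ((\<alpha> - \<beta>)\<^sup>2 * (\<alpha>\<^sup>2 + b * \<alpha> + c)\<^sup>2 * (\<beta>\<^sup>2 + b * \<beta> + c)\<^sup>2 * (b\<^sup>2 - 4 * c))"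
    unfolding vals zw by simp
  finally have 1: "(\<Prod>j<length (complex_roots P). \<Prod>i<j. (complex_roots P ! i - complex_roots P ! j)\<^sup>2) = \<dots>" .
  have 2: "lead_coeff P = l" "degree P = 4"
    using assms by (simp_all add: lead_coeff_mult degree_mult_eq)
  show ?thesis
    unfolding discriminant_def Let_def 1 Re_complex_of_real 2(1) unfolding 2(2) by simp
qed

text \<open>Because \<open>a\<close> and \<open>b\<close> differ, only \<open>r\<close> can have
  order at least 2, also when it coincides with one of them and has order 3.\<close>

lemma multiple_root_eq:
  assumes P: "P = smult l ([:-r, 1:]\<^sup>2 * [:-a, 1:] * [:-b, 1:])" and "l \<noteq> 0" "a \<noteq> b"
  shows "multiple_root P = r"
proof -
  have "order x P = (if x = r then 2 else 0) + (if x = a then 1 else 0) + (if x = b then 1 else 0)" for x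
  proof -
    have o: "order x [:-y, 1:] = (if x = y then 1 else 0)" for y :: real
      using count_proots[of "[:-y, 1:]" x] unfolding proots_linear_factor by (simp split: if_splits)
    show ?thesis
      using \<open>l \<noteq> 0\<close> unfolding P power2_eq_square
      by (simp add: order_smult order_mult o del: mult_pCons_left mult_pCons_right)
  qed
  then show ?thesis
    unfolding multiple_root_def using \<open>a \<noteq> b\<close> by (intro the_equality) (auto split: if_splits)
qed

text \<open>The nearest roots on either side of \<xi> bound the interval in which a motion through
  \<xi> takes place.\<close>

lemma poly_positive_between_roots:
  fixes P :: "real poly"
  assumes "poly P \<xi> > 0" "u < \<xi>" "poly P u < 0" "\<xi> < v" "poly P v < 0"
  obtains \<alpha> \<beta> where "\<alpha> < \<xi>" "\<xi> < \<beta>" "poly P \<alpha> = 0" "poly P \<beta> = 0"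
    "\<And>x. \<alpha> < x \<Longrightarrow> x < \<beta> \<Longrightarrow> poly P x > 0"
proof -
  have fin: "finite {x. poly P x = 0}" using assms(1) by (intro poly_roots_finite) auto
  define \<alpha> where "\<alpha> = Max {x. poly P x = 0 \<and> x < \<xi>}"
  define \<beta> where "\<beta> = Min {x. poly P x = 0 \<and> \<xi> < x}"
  have "{x. poly P x = 0 \<and> x < \<xi>} \<noteq> {}" using poly_IVT_pos[of u \<xi> P] assms by auto
  then have \<alpha>: "poly P \<alpha> = 0" "\<alpha> < \<xi>" "\<And>x. poly P x = 0 \<Longrightarrow> x < \<xi> \<Longrightarrow> x \<le> \<alpha>"
    using Max_in[of "{x. poly P x = 0 \<and> x < \<xi>}"] Max_ge[of "{x. poly P x = 0 \<and> x < \<xi>}"] fin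
    by (simp_all add: \<alpha>_def)
  have "{x. poly P x = 0 \<and> \<xi> < x} \<noteq> {}" using poly_IVT_neg[of \<xi> v P] assms by auto
  then have \<beta>: "poly P \<beta> = 0" "\<xi> < \<beta>" "\<And>x. poly P x = 0 \<Longrightarrow> \<xi> < x \<Longrightarrow> \<beta> \<le> x"
    using Min_in[of "{x. poly P x = 0 \<and> \<xi> < x}"] Min_le[of "{x. poly P x = 0 \<and> \<xi> < x}"] fin
    by (simp_all add: \<beta>_def)
  have "poly P x > 0" if "\<alpha> < x" "x < \<beta>" for x
  proof (rule ccontr)
    assume "\<not> ?thesis"
    moreover have "poly P x \<noteq> 0"
      using \<alpha>(3)[of x] \<beta>(3)[of x] assms(1) that by (cases x \<xi> rule: linorder_cases) auto
    ultimately have "poly P x < 0" by simp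
    then show False
      using poly_IVT_pos[of x \<xi> P] poly_IVT_neg[of \<xi> x P] assms(1) \<alpha>(3) \<beta>(3) that
      by (cases x \<xi> rule: linorder_cases) force+
  qed
  with \<alpha> \<beta> show ?thesis by (intro that[of \<alpha> \<beta>])
qed

section \<open>The quartic of a magnetic trajectory\<close>

lemma poly_heis_quartic:
  "poly (heis_quartic \<rho> x0 y0 z0) x =
    - 1/4 * (x ^ 4 + 2 * heis_p0 \<rho> x0 y0 z0 * x\<^sup>2 - 8 * \<rho> * x + heis_q0 \<rho> x0 y0 z0)"
  by (simp add: heis_quartic_def algebra_simps power2_eq_square eval_nat_numeral)

lemma poly_pderiv_heis_quartic:
  "poly (pderiv (heis_quartic \<rho> x0 y0 z0)) x = - (x ^ 3 + heis_p0 \<rho> x0 y0 z0 * x - 2 * \<rho>)"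
  by (simp add: heis_quartic_def pderiv_pCons pderiv_smult algebra_simps eval_nat_numeral)

text \<open>By these values the hypothesis of part (b) says that the initial position is not a
  common root of the quartic and its derivative, that is, not an equilibrium.\<close>

lemma heis_quartic_initial:
  "poly (heis_quartic \<rho> x0 y0 z0) (z0 + \<rho>) = x0\<^sup>2"
  "poly (pderiv (heis_quartic \<rho> x0 y0 z0)) (z0 + \<rho>) = 2 * (\<rho> - (y0 + 1) * (z0 + \<rho>))"
proof -
  have p: "heis_p0 \<rho> x0 y0 z0 = 2 * (y0 + 1) - (z0 + \<rho>)\<^sup>2" by (simp add: heis_p0_def)
  define h where "h = z0 + \<rho>"
  show "poly (heis_quartic \<rho> x0 y0 z0) (z0 + \<rho>) = x0\<^sup>2"
    unfolding poly_heis_quartic heis_q0_def p h_def[symmetric]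
    by (simp add: field_simps power2_eq_square eval_nat_numeral)
  show "poly (pderiv (heis_quartic \<rho> x0 y0 z0)) (z0 + \<rho>) = 2 * (\<rho> - (y0 + 1) * (z0 + \<rho>))"
    unfolding poly_pderiv_heis_quartic p h_def[symmetric]
    by (simp add: algebra_simps power2_eq_square eval_nat_numeral)
qed

lemma heis_quartic_negative:
  obtains u v where "u < \<xi>" "poly (heis_quartic \<rho> x0 y0 z0) u < 0"
    "\<xi> < v" "poly (heis_quartic \<rho> x0 y0 z0) v < 0"
proof -
  let ?P = "heis_quartic \<rho> x0 y0 z0"
  have 1: "lead_coeff (- ?P) > 0" "lead_coeff (- pcompose ?P [:0, -1:]) > 0"
    by (simp_all add: heis_quartic_def pcompose_pCons)
  obtain m n where m: "\<And>x. x \<ge> m \<Longrightarrow> poly (- ?P) x \<ge> lead_coeff (- ?P)"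
    and n: "\<And>x. x \<ge> n \<Longrightarrow> poly (- pcompose ?P [:0, -1:]) x \<ge> lead_coeff (- pcompose ?P [:0, -1:])"
    using poly_pinfty_gt_lc[OF 1(1)] poly_pinfty_gt_lc[OF 1(2)] by blast
  show ?thesis
  proof (rule that[of "- max n (1 - \<xi>)" "max m (\<xi> + 1)"])
    show "poly ?P (max m (\<xi> + 1)) < 0" using m[of "max m (\<xi> + 1)"] 1(1) by simp
    have "poly (- pcompose ?P [:0, -1:]) (max n (1 - \<xi>)) > 0"
      using n[of "max n (1 - \<xi>)"] 1(2) by linarith
    then show "poly ?P (- max n (1 - \<xi>)) < 0" by (simp add: poly_pcompose)
  qed auto
qed

lemma heis_quartic_factor:
  assumes "x0\<^sup>2 + (\<rho> - (y0 + 1) * (z0 + \<rho>))\<^sup>2 \<noteq> 0"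
  obtains \<alpha> \<beta> c where "\<alpha> < \<beta>" "\<alpha> \<le> z0 + \<rho>" "z0 + \<rho> \<le> \<beta>"
    "\<And>x. poly (heis_quartic \<rho> x0 y0 z0) x = - 1/4 * (x - \<alpha>) * (x - \<beta>) * (x\<^sup>2 + (\<alpha> + \<beta>) * x + c)"
    "\<And>x. \<alpha> \<le> x \<Longrightarrow> x \<le> \<beta> \<Longrightarrow> x\<^sup>2 + (\<alpha> + \<beta>) * x + c \<ge> 0"
proof -
  let ?P = "heis_quartic \<rho> x0 y0 z0" and ?h = "z0 + \<rho>"
  \<comment> \<open>If the motion starts at rest, the initial position is a simple root and \<xi> is
    taken on the side where the quartic grows. Positivity between \<xi> and the initial position
    keeps the latter within the roots that enclose \<xi>.\<close>
  obtain \<xi> where \<xi>: "poly ?P \<xi> > 0"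
    "\<And>x. ?h < x \<Longrightarrow> x \<le> \<xi> \<Longrightarrow> poly ?P x > 0" "\<And>x. \<xi> \<le> x \<Longrightarrow> x < ?h \<Longrightarrow> poly ?P x > 0"
  proof (cases "x0 = 0")
    case False
    then show ?thesis by (intro that[of ?h]) (simp_all add: heis_quartic_initial)
  next
    case True
    then have P0: "poly ?P ?h = 0" and "poly (pderiv ?P) ?h \<noteq> 0"
      using assms by (simp_all add: heis_quartic_initial)
    then consider "poly (pderiv ?P) ?h > 0" | "poly (pderiv ?P) ?h < 0" by linarith
    then show ?thesis
    proof cases
      case 1
      from DERIV_pos_inc_right[OF poly_DERIV this] obtain d where
        d: "d > 0" "\<And>t. 0 < t \<Longrightarrow> t < d \<Longrightarrow> poly ?P ?h < poly ?P (?h + t)" by blast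
      have "poly ?P x > 0" if "?h < x" "x \<le> ?h + d / 2" for x
        using d(2)[of "x - ?h"] that d(1) P0 by simp
      with d(1) show ?thesis by (intro that[of "?h + d / 2"]) auto
    next
      case 2
      from DERIV_neg_dec_left[OF poly_DERIV this] obtain d where
        d: "d > 0" "\<And>t. 0 < t \<Longrightarrow> t < d \<Longrightarrow> poly ?P ?h < poly ?P (?h - t)" by blast
      have "poly ?P x > 0" if "?h - d / 2 \<le> x" "x < ?h" for x
        using d(2)[of "?h - x"] that d(1) P0 by simp
      with d(1) show ?thesis by (intro that[of "?h - d / 2"]) auto
    qed
  qed
  obtain u v where "u < \<xi>" "poly ?P u < 0" "\<xi> < v" "poly ?P v < 0"
    by (rule heis_quartic_negative)
  then obtain \<alpha> \<beta> where ab: "\<alpha> < \<xi>" "\<xi> < \<beta>" "poly ?P \<alpha> = 0" "poly ?P \<beta> = 0"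
    and pos: "\<And>x. \<alpha> < x \<Longrightarrow> x < \<beta> \<Longrightarrow> poly ?P x > 0"
    using poly_positive_between_roots[OF \<xi>(1)] by metis
  have less: "\<alpha> < \<beta>" using ab by simp
  have h: "\<alpha> \<le> ?h" "?h \<le> \<beta>"
    using \<xi>(2)[of \<beta>] \<xi>(2)[of \<alpha>] \<xi>(3)[of \<alpha>] \<xi>(3)[of \<beta>] ab by force+
  let ?p = "heis_p0 \<rho> x0 y0 z0" and ?q = "heis_q0 \<rho> x0 y0 z0"
  \<comment> \<open>Read off from the coefficient of \<open>x\<^sup>2\<close>. The absence of a
    cubic term has already fixed the linear coefficient of the cofactor as \<alpha> + \<beta>, and
    subtracting the two root equations accounts for the linear coefficient of the quartic.\<close>
  define c where "c = 2 * ?p + (\<alpha> + \<beta>)\<^sup>2 - \<alpha> * \<beta>"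
  have roots: "\<alpha> ^ 4 + 2 * ?p * \<alpha>\<^sup>2 - 8 * \<rho> * \<alpha> + ?q = 0" "\<beta> ^ 4 + 2 * ?p * \<beta>\<^sup>2 - 8 * \<rho> * \<beta> + ?q = 0"
    using ab(3,4) unfolding poly_heis_quartic by simp_all
  have "(\<alpha> - \<beta>) * (\<alpha> * \<beta> * (\<alpha> + \<beta>) - c * (\<alpha> + \<beta>) + 8 * \<rho>) = 0"
    using roots unfolding c_def by algebra
  then have lin: "8 * \<rho> = c * (\<alpha> + \<beta>) - \<alpha> * \<beta> * (\<alpha> + \<beta>)" using less by simp
  have const: "?q = \<alpha> * \<beta> * c"
    using roots(1) lin unfolding c_def by algebra
  have P: "poly ?P x = - 1/4 * (x - \<alpha>) * (x - \<beta>) * (x\<^sup>2 + (\<alpha> + \<beta>) * x + c)" for x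
  proof -
    have "x ^ 4 + 2 * ?p * x\<^sup>2 - 8 * \<rho> * x + ?q = (x - \<alpha>) * (x - \<beta>) * (x\<^sup>2 + (\<alpha> + \<beta>) * x + c)"
      unfolding lin const c_def by algebra
    then show ?thesis unfolding poly_heis_quartic by simp
  qed
  have Q: "x\<^sup>2 + (\<alpha> + \<beta>) * x + c > 0" if "\<alpha> < x" "x < \<beta>" for x
  proof -
    have "(x - \<alpha>) * (\<beta> - x) * (x\<^sup>2 + (\<alpha> + \<beta>) * x + c) > 0"
      using pos[OF that] unfolding P by (simp add: algebra_simps)
    moreover have "(x - \<alpha>) * (\<beta> - x) > 0" using that by simp
    ultimately show ?thesis by (metis zero_less_mult_pos)
  qed
  have "x\<^sup>2 + (\<alpha> + \<beta>) * x + c \<ge> 0" if "\<alpha> \<le> x" "x \<le> \<beta>" for x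
    by (rule continuous_ge_on_closure[of "{\<alpha><..<\<beta>}" "\<lambda>x. x\<^sup>2 + (\<alpha> + \<beta>) * x + c"])
      (use that less Q in \<open>auto intro!: continuous_intros simp: less_imp_le\<close>)
  with less h P show ?thesis by (intro that)
qed

text \<open>Vieta's relations with zero root sum. For \<open>a < b\<close> a positive value puts
  \<open>r\<close> outside the interval from \<open>a\<close> to \<open>b\<close>, and a value at
  most 0 puts it inside or at an end.\<close>

lemma heis_mu_double_root:
  assumes P: "\<And>x. poly (heis_quartic \<rho> x0 y0 z0) x = - 1/4 * (x - r)\<^sup>2 * (x - a) * (x - b)"
    and "a \<noteq> b"
  shows "heis_mu \<rho> x0 y0 z0 = (r - a) * (r - b) / 4"
proof -
  have eq: "heis_quartic \<rho> x0 y0 z0 = smult (- 1/4) ([:-r, 1:]\<^sup>2 * [:-a, 1:] * [:-b, 1:])"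
    by (rule poly_eq_poly_eq_iff[THEN iffD1], rule ext) (simp add: P power2_eq_square field_simps)
  have r: "multiple_root (heis_quartic \<rho> x0 y0 z0) = r"
    by (rule multiple_root_eq[OF eq]) (use \<open>a \<noteq> b\<close> in auto)
  have "coeff (heis_quartic \<rho> x0 y0 z0) 3 = 0"
    "coeff (heis_quartic \<rho> x0 y0 z0) 2 = - heis_p0 \<rho> x0 y0 z0 / 2"
    by (simp_all add: heis_quartic_def eval_nat_numeral)
  note c = this[unfolded eq]
  have "a + b = - 2 * r"
    using c(1) by (simp add: eval_nat_numeral field_simps)
  moreover have "2 * heis_p0 \<rho> x0 y0 z0 = a * b + 2 * r * (a + b) + r\<^sup>2"
    using c(2) by (simp add: eval_nat_numeral field_simps)
  ultimately have "2 * heis_p0 \<rho> x0 y0 z0 + 6 * r\<^sup>2 = (r - a) * (r - b)"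
    by algebra
  then show ?thesis unfolding heis_mu_def r by simp
qed

lemma heis_disc_factored:
  assumes "\<And>x. poly (heis_quartic \<rho> x0 y0 z0) x = - 1/4 * (x - \<alpha>) * (x - \<beta>) * (x\<^sup>2 + b * x + c)"
  shows "heis_disc \<rho> x0 y0 z0 = (1/4) ^ 6 *
    ((\<alpha> - \<beta>)\<^sup>2 * (\<alpha>\<^sup>2 + b * \<alpha> + c)\<^sup>2 * (\<beta>\<^sup>2 + b * \<beta> + c)\<^sup>2 * (b\<^sup>2 - 4 * c))"
proof -
  have "heis_quartic \<rho> x0 y0 z0 = smult (- 1/4) ([:-\<alpha>, 1:] * [:-\<beta>, 1:] * [:c, b, 1:])"
    by (rule poly_eq_poly_eq_iff[THEN iffD1], rule ext) (simp add: assms power2_eq_square field_simps)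
  from discriminant_quartic[OF this] show ?thesis by (simp add: heis_disc_def)
qed

text \<open>The factored discriminant vanishes when an end of the interval of motion is itself
  multiple or when the cofactor is a square. In the last case the motion starts between the other
  two roots, which is what the period formula for \<mu> > 0 needs; in the first two the double root
  lies between the others, so \<mu> is not positive.\<close>

lemma heis_disc_zero:
  assumes nd: "x0\<^sup>2 + (\<rho> - (y0 + 1) * (z0 + \<rho>))\<^sup>2 \<noteq> 0" and disc: "heis_disc \<rho> x0 y0 z0 = 0"
  obtains r a b where "a < b"
    "\<And>x. poly (heis_quartic \<rho> x0 y0 z0) x = - 1/4 * (x - r)\<^sup>2 * (x - a) * (x - b)"
    "a \<le> r \<and> r \<le> b \<or> a \<le> z0 + \<rho> \<and> z0 + \<rho> \<le> b"
proof -
  obtain \<alpha> \<beta> c where ab: "\<alpha> < \<beta>" "\<alpha> \<le> z0 + \<rho>" "z0 + \<rho> \<le> \<beta>"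
    and P: "\<And>x. poly (heis_quartic \<rho> x0 y0 z0) x = - 1/4 * (x - \<alpha>) * (x - \<beta>) * (x\<^sup>2 + (\<alpha> + \<beta>) * x + c)"
    and Q: "\<And>x. \<alpha> \<le> x \<Longrightarrow> x \<le> \<beta> \<Longrightarrow> x\<^sup>2 + (\<alpha> + \<beta>) * x + c \<ge> 0"
    using heis_quartic_factor[OF nd] by metis
  consider "\<alpha>\<^sup>2 + (\<alpha> + \<beta>) * \<alpha> + c = 0" | "\<beta>\<^sup>2 + (\<alpha> + \<beta>) * \<beta> + c = 0" | "(\<alpha> + \<beta>)\<^sup>2 - 4 * c = 0"
    using disc heis_disc_factored[OF P] ab(1) by auto
  then show ?thesis
  proof cases
    case 1
    define t where "t = - 2 * \<alpha> - \<beta>"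
    have Q': "x\<^sup>2 + (\<alpha> + \<beta>) * x + c = (x - \<alpha>) * (x - t)" for x
      using 1 unfolding t_def by algebra
    \<comment> \<open>Otherwise the cofactor would be negative just to the right of \<alpha>, inside
      the interval of motion.\<close>
    have "t \<le> \<alpha>"
    proof (rule ccontr)
      assume "\<not> t \<le> \<alpha>"
      define x where "x = (\<alpha> + min t \<beta>) / 2"
      have "\<alpha> < x" "x < t" "x \<le> \<beta>" using \<open>\<not> t \<le> \<alpha>\<close> ab(1) by (auto simp: x_def)
      with Q[of x] show False unfolding Q' by (simp add: zero_le_mult_iff)
    qed
    moreover have "poly (heis_quartic \<rho> x0 y0 z0) x = - 1/4 * (x - \<alpha>)\<^sup>2 * (x - t) * (x - \<beta>)" for x
      unfolding P Q' by (simp add: power2_eq_square)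
    ultimately show ?thesis
      by (intro that[of t \<beta> \<alpha>]) (use ab in auto)
  next
    case 2
    define t where "t = - \<alpha> - 2 * \<beta>"
    have Q': "x\<^sup>2 + (\<alpha> + \<beta>) * x + c = (x - \<beta>) * (x - t)" for x
      using 2 unfolding t_def by algebra
    have "\<beta> \<le> t"
    proof (rule ccontr)
      assume "\<not> \<beta> \<le> t"
      define x where "x = (max \<alpha> t + \<beta>) / 2"
      have "\<alpha> \<le> x" "t < x" "x < \<beta>" using \<open>\<not> \<beta> \<le> t\<close> ab(1) by (auto simp: x_def)
      with Q[of x] show False unfolding Q' by (simp add: zero_le_mult_iff)
    qed
    moreover have "poly (heis_quartic \<rho> x0 y0 z0) x = - 1/4 * (x - \<beta>)\<^sup>2 * (x - \<alpha>) * (x - t)" for x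
      unfolding P Q' by (simp add: power2_eq_square)
    ultimately show ?thesis
      by (intro that[of \<alpha> t \<beta>]) (use ab in auto)
  next
    case 3
    have "x\<^sup>2 + (\<alpha> + \<beta>) * x + c = (x - (- (\<alpha> + \<beta>) / 2))\<^sup>2" for x
      using 3 by (simp add: power2_eq_square field_simps)
    then show ?thesis
      by (intro that[of \<alpha> \<beta> "- (\<alpha> + \<beta>) / 2"]) (use ab P in auto)
  qed
qed

text \<open>The elementary period for \<open>\<Delta> = 0\<close>, \<open>\<mu> > 0\<close> is the four-root period with two coinciding outer roots:
  then \<open>k = 0\<close> and \<open>K(0) = \<pi>/2\<close>.\<close>

lemma heis_potential_periodic:
  assumes nd: "x0\<^sup>2 + (\<rho> - (y0 + 1) * (z0 + \<rho>))\<^sup>2 \<noteq> 0"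
    and cond: "heis_disc \<rho> x0 y0 z0 \<noteq> 0 \<or> heis_disc \<rho> x0 y0 z0 = 0 \<and> heis_mu \<rho> x0 y0 z0 > 0"
    and X: "energy_solution (heis_quartic \<rho> x0 y0 z0) X X'" and X0: "X 0 = z0 + \<rho>"
  defines "\<omega> \<equiv> heis_period \<rho> x0 y0 z0"
  shows "\<omega> > 0 \<and> (\<forall>t. X (t + \<omega>) = X t)"
proof -
  let ?P = "heis_quartic \<rho> x0 y0 z0"
  obtain \<alpha> \<beta> c where ab: "\<alpha> < \<beta>" "\<alpha> \<le> z0 + \<rho>" "z0 + \<rho> \<le> \<beta>"
    and P: "\<And>x. poly ?P x = - 1/4 * (x - \<alpha>) * (x - \<beta>) * (x\<^sup>2 + (\<alpha> + \<beta>) * x + c)"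
    and Q: "\<And>x. \<alpha> \<le> x \<Longrightarrow> x \<le> \<beta> \<Longrightarrow> x\<^sup>2 + (\<alpha> + \<beta>) * x + c \<ge> 0"
    using heis_quartic_factor[OF nd] by metis
  define b where "b = \<alpha> + \<beta>"
  note P = P[folded b_def] and Q = Q[folded b_def]
  \<comment> \<open>The discriminant is this nonnegative number times
    \<open>b\<^sup>2 - 4 * c\<close>, so its sign, when nonzero, decides whether the cofactor has
    real roots.\<close>
  define k where "k = (1/4) ^ 6 * ((\<alpha> - \<beta>)\<^sup>2 * (\<alpha>\<^sup>2 + b * \<alpha> + c)\<^sup>2 * (\<beta>\<^sup>2 + b * \<beta> + c)\<^sup>2)"
  have disc: "heis_disc \<rho> x0 y0 z0 = k * (b\<^sup>2 - 4 * c)" and "k \<ge> 0"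
    unfolding heis_disc_factored[OF P] by (simp_all add: k_def)
  have Qpos: "\<alpha>\<^sup>2 + b * \<alpha> + c > 0" "\<beta>\<^sup>2 + b * \<beta> + c > 0" if "heis_disc \<rho> x0 y0 z0 \<noteq> 0"
    using that Q[of \<alpha>] Q[of \<beta>] ab(1) by (auto simp: disc k_def less_le)
  consider "heis_disc \<rho> x0 y0 z0 < 0" | "heis_disc \<rho> x0 y0 z0 > 0"
    | "heis_disc \<rho> x0 y0 z0 = 0" "heis_mu \<rho> x0 y0 z0 > 0"
    using cond by linarith
  then show ?thesis
  proof cases
    case 1
    have D: "b\<^sup>2 < 4 * c" using 1 \<open>k \<ge> 0\<close> by (simp add: disc mult_less_0_iff)
    have Qn: "x\<^sup>2 + b * x + c > 0" for x
      using D zero_le_power2[of "x + b / 2"] by (simp add: power2_eq_square field_simps)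
    have roots: "{x. poly ?P x = 0} = {\<alpha>, \<beta>}"
      using Qn by (auto simp: P less_imp_neq[symmetric])
    \<comment> \<open>Whichever non-real root is chosen, its real part and the square of its
      imaginary part are determined by the cofactor, and so are its distances to \<alpha> and
      \<beta>.\<close>
    define z where "z = (SOME z. poly (map_poly complex_of_real ?P) z = 0 \<and> Im z \<noteq> 0)"
    have eqP: "?P = smult (- 1/4) ([:-\<alpha>, 1:] * [:-\<beta>, 1:] * [:c, b, 1:])"
      by (rule poly_eq_poly_eq_iff[THEN iffD1], rule ext) (simp add: P power2_eq_square field_simps)
    have polyC: "poly (map_poly complex_of_real ?P) z =
        - 1/4 * (z - of_real \<alpha>) * (z - of_real \<beta>) * (z\<^sup>2 + of_real b * z + of_real c)" for z
      unfolding eqP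
      by (simp add: map_poly_pCons power2_eq_square algebra_simps add_divide_distrib diff_divide_distrib)
    define y where "y = sqrt (c - b\<^sup>2 / 4)"
    have y: "y > 0" "y\<^sup>2 = c - b\<^sup>2 / 4" using D by (simp_all add: y_def)
    have "(Complex (- b / 2) y)\<^sup>2 + of_real b * Complex (- b / 2) y + of_real c = 0"
      using y(2) by (simp add: complex_eq_iff power2_eq_square field_simps)
    then have "poly (map_poly complex_of_real ?P) (Complex (- b / 2) y) = 0 \<and> Im (Complex (- b / 2) y) \<noteq> 0"
      using y(1) unfolding polyC by simp
    then have "poly (map_poly complex_of_real ?P) z = 0 \<and> Im z \<noteq> 0"
      unfolding z_def by (rule someI)
    then have Im: "Im z \<noteq> 0" and "poly (map_poly complex_of_real ?P) z = 0" by auto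
    moreover have "z \<noteq> of_real x" for x using Im by auto
    ultimately have "z\<^sup>2 + of_real b * z + of_real c = 0" unfolding polyC by simp
    then have z: "Re z = - b / 2" "(Im z)\<^sup>2 = c - b\<^sup>2 / 4"
    proof -
      have "Im z * (2 * Re z + b) = 0" "(Re z)\<^sup>2 - (Im z)\<^sup>2 + b * Re z + c = 0"
        using \<open>z\<^sup>2 + of_real b * z + of_real c = 0\<close>
        by (simp_all add: complex_eq_iff power2_eq_square algebra_simps)
      then have *: "2 * Re z + b = 0" "(Im z)\<^sup>2 = (Re z)\<^sup>2 + b * Re z + c" using Im by simp_all
      then show re: "Re z = - b / 2" by simp
      show "(Im z)\<^sup>2 = c - b\<^sup>2 / 4" unfolding *(2) re by (simp add: power2_eq_square field_simps)
    qed
    have cmod: "(cmod (of_real x - z))\<^sup>2 = x\<^sup>2 + b * x + c" for x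
      unfolding cmod_power2 using z(2) by (simp add: z(1) power2_eq_square field_simps)
    have cmod_pos: "cmod (of_real x - z) > 0" for x
      using Im by (auto simp: complex_eq_iff)
    note per = period_conjugate_roots[OF X P ab(1) D cmod_pos cmod cmod_pos cmod]
    have "\<omega> = 8 * ellipticK (sqrt (((\<beta> - \<alpha>)\<^sup>2 - (cmod (of_real \<beta> - z) - cmod (of_real \<alpha> - z))\<^sup>2)
        / (4 * cmod (of_real \<beta> - z) * cmod (of_real \<alpha> - z)))) /
        sqrt (cmod (of_real \<beta> - z) * cmod (of_real \<alpha> - z))"
      using 1 ab(1) unfolding \<omega>_def heis_period_def period_two_real_def Let_def roots z_def[symmetric]
      by (simp add: mult_ac)
    with per show ?thesis by simp
  next
    case 2
    have D: "b\<^sup>2 - 4 * c > 0" using 2 \<open>k \<ge> 0\<close> by (simp add: disc zero_less_mult_iff)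
    define s where "s = sqrt (b\<^sup>2 - 4 * c)"
    have s: "s > 0" "s\<^sup>2 = b\<^sup>2 - 4 * c" using D by (simp_all add: s_def)
    define u v where "u = (- b - s) / 2" and "v = (- b + s) / 2"
    have uv: "u < v" using s by (simp add: u_def v_def)
    have Q': "x\<^sup>2 + b * x + c = (x - u) * (x - v)" for x
      using s(2) by (simp add: u_def v_def power2_eq_square field_simps)
    have P': "poly ?P x = - 1/4 * (x - \<alpha>) * (x - \<beta>) * (x - u) * (x - v)" for x
      unfolding P Q' by simp
    have q: "(\<alpha> - u) * (\<alpha> - v) > 0" "(\<beta> - u) * (\<beta> - v) > 0" using Qpos 2 by (simp_all add: Q')
    \<comment> \<open>The cofactor is positive at \<alpha> and \<beta>, so neither of these
      separates its roots; and both roots cannot lie inside the interval, where the cofactor would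
      be negative between them.\<close>
    have "v < \<alpha> \<or> \<beta> < u"
    proof (rule ccontr)
      assume *: "\<not> ?thesis"
      then have "u > \<alpha>" "v < \<beta>" using q uv by (auto simp: zero_less_mult_iff)
      then show False using Q[of "(u + v) / 2"] uv unfolding Q'
        by (simp add: zero_le_mult_iff)
    qed
    then show ?thesis
    proof
      assume v: "v < \<alpha>"
      have "{x. poly ?P x = 0} = set [u, v, \<alpha>, \<beta>]" by (auto simp: P')
      then have rs: "sorted_list_of_set {x. poly ?P x = 0} = [u, v, \<alpha>, \<beta>]"
        using uv v ab(1) by (simp only: sorted_list_of_set_sort_remdups) (simp add: sort_key_simps)
      show ?thesis
        using period_roots_below[OF X _ _ v ab(1), of u] P' uv ab(2) 2 X0
        unfolding \<omega>_def heis_period_def period_four_real_def Let_def rs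
        by (simp add: mult_ac)
    next
      assume u: "\<beta> < u"
      have "{x. poly ?P x = 0} = set [\<alpha>, \<beta>, u, v]" by (auto simp: P')
      then have rs: "sorted_list_of_set {x. poly ?P x = 0} = [\<alpha>, \<beta>, u, v]"
        using uv u ab(1) by (simp only: sorted_list_of_set_sort_remdups) (simp add: sort_key_simps)
      show ?thesis
        using period_roots_above[OF X _ ab(1) u, of v] P' uv ab(3) 2 X0
        unfolding \<omega>_def heis_period_def period_four_real_def Let_def rs
        by (simp add: mult_ac)
    qed
  next
    case 3
    obtain r a b where ab: "a < b"
      and P: "\<And>x. poly ?P x = - 1/4 * (x - r)\<^sup>2 * (x - a) * (x - b)"
      and mem: "a \<le> r \<and> r \<le> b \<or> a \<le> z0 + \<rho> \<and> z0 + \<rho> \<le> b"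
      using heis_disc_zero[OF nd 3(1)] by metis
    have mu: "heis_mu \<rho> x0 y0 z0 = (r - a) * (r - b) / 4"
      using heis_mu_double_root[OF P] ab by simp
    have pos: "(r - a) * (r - b) > 0" using 3(2) mu by simp
    then have out: "r < a \<or> b < r" by (auto simp: zero_less_mult_iff)
    have P': "poly ?P x = - 1/4 * (x - a) * (x - b) * (x - r) * (x - r)" for x
      by (simp add: P power2_eq_square)
    have K0: "ellipticK 0 = pi / 2" by (simp add: ellipticK_def)
    have sqrt_mu: "sqrt (heis_mu \<rho> x0 y0 z0) = sqrt ((r - a) * (r - b)) / 2"
      unfolding mu by (simp add: real_sqrt_divide)
    have \<omega>: "\<omega> = 8 * ellipticK 0 / sqrt ((r - a) * (r - b))"
      using 3(1) by (simp add: \<omega>_def heis_period_def K0 sqrt_mu)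
    from out show ?thesis
    proof
      assume r: "r < a"
      have "(b - r) * (a - r) = (r - a) * (r - b)" by (simp add: algebra_simps)
      then show ?thesis
        using period_roots_below[OF X P' order_refl r ab] mem r X0 unfolding \<omega> by auto
    next
      assume r: "b < r"
      then show ?thesis
        using period_roots_above[OF X P' ab r order_refl] mem X0 unfolding \<omega> by auto
    qed
  qed
qed

text \<open>The case distinctions on the identity separate true periodicity from
  \<lambda>-periodicity, which requires a nontrivial \<lambda>. In (a) the identity occurs exactly
  for \<open>y0 = z0 = 0\<close>, when the curve is constant.\<close>

theorem proposition4p7:
  fixes \<rho> x0 y0 z0 :: real and \<sigma> :: "real \<Rightarrow> real^3"
  assumes "\<rho> \<ge> 0"
    and "magnetic_trajectory heis_metric (lorentz_force \<rho>) \<sigma>"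
    and "\<sigma> 0 = 0"
    and "velocity \<sigma> 0 = x0 *\<^sub>R e1 0 + y0 *\<^sub>R e2 0 + z0 *\<^sub>R e3 0"
  shows
    "(x0 = 0 \<and> (y0 + 1) * (z0 + \<rho>) = \<rho> \<longrightarrow>
       (\<forall>r. r \<noteq> 0 \<longrightarrow>
          (let l = heis_exp (vector [0, y0 * r, z0 * r]) in
             if l = 0 then \<forall>t. \<sigma> (t + r) = \<sigma> t else lambda_periodic_with l r \<sigma>)))
     \<and>
     (x0\<^sup>2 + (\<rho> - (y0 + 1) * (z0 + \<rho>))\<^sup>2 \<noteq> 0 \<longrightarrow>
       (heis_disc \<rho> x0 y0 z0 \<noteq> 0 \<or> heis_disc \<rho> x0 y0 z0 = 0 \<and> heis_mu \<rho> x0 y0 z0 > 0 \<longrightarrow>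
          (let \<omega> = heis_period \<rho> x0 y0 z0 in
             if \<sigma> \<omega> = 0 then periodic_with \<omega> \<sigma> else lambda_periodic_with (\<sigma> \<omega>) \<omega> \<sigma>)) \<and>
       (heis_disc \<rho> x0 y0 z0 = 0 \<and> heis_mu \<rho> x0 y0 z0 \<le> 0 \<longrightarrow>
          (\<forall>l. \<not> lambda_periodic l \<sigma>)))"
proof -
  let ?P = "heis_quartic \<rho> x0 y0 z0" and ?p = "heis_p0 \<rho> x0 y0 z0"
  define W where "W t = heis_coords (\<sigma> t) (velocity \<sigma> t)" for t
  note d = magnetic_trajectory_heis[OF assms(2), folded W_def]
  have "velocity \<sigma> 0 = left_field (vector [x0, y0, z0]) (\<sigma> 0)"
    unfolding assms(3,4) left_field_def by simp
  then have W0: "W 0 $ 1 = x0" "W 0 $ 2 = y0" "W 0 $ 3 = z0" by (simp_all add: W_def)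
  have const: "f t = f 0" if "\<And>t. (f has_real_derivative 0) (at t)" for f :: "real \<Rightarrow> real" and t
    using DERIV_isconst_all that by blast
  define X where "X t = W t $ 3 + \<rho>" for t
  have X0: "X 0 = z0 + \<rho>" by (simp add: X_def W0)
  have dX: "(X has_real_derivative W t $ 1) (at t)" for t
    unfolding X_def[abs_def] by (auto intro!: derivative_eq_intros d)
  \<comment> \<open>A second first integral: it expresses \<open>W t $ 2\<close> through
    \<open>X t\<close>, with \<open>heis_p0\<close> as its constant, and so reduces the system to
    one equation for \<open>X\<close>.\<close>
  have "((\<lambda>t. W t $ 2 - (X t)\<^sup>2 / 2) has_real_derivative 0) (at t)" for t
    by (auto intro!: derivative_eq_intros d dX simp: X_def algebra_simps)
  from const[OF this] have W2: "W t $ 2 = ((X t)\<^sup>2 + ?p) / 2 - 1" for t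
    by (simp add: W0 X0 heis_p0_def algebra_simps diff_divide_distrib add_divide_distrib)
  have dW1: "((\<lambda>t. W t $ 1) has_real_derivative \<rho> - X t * ((X t)\<^sup>2 + ?p) / 2) (at t)" for t
  proof (rule DERIV_cong[OF d(2)])
    have W3: "W t $ 3 = X t - \<rho>" by (simp add: X_def)
    show "- W t $ 2 * W t $ 3 - \<rho> * W t $ 2 - W t $ 3 = \<rho> - X t * ((X t)\<^sup>2 + ?p) / 2"
      unfolding W2 W3 by (simp add: field_simps)
  qed
  have "((\<lambda>t. (W t $ 1)\<^sup>2 - poly ?P (X t)) has_real_derivative 0) (at t)" for t
    by (rule derivative_eq_intros dW1 DERIV_chain2[OF poly_DERIV dX] refl)+
      (simp add: poly_pderiv_heis_quartic field_simps power2_eq_square power3_eq_cube)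
  from const[OF this] have energy: "(W t $ 1)\<^sup>2 = poly ?P (X t)" for t
    by (simp add: W0 X0 heis_quartic_initial)
  have sol: "energy_solution ?P X (\<lambda>t. W t $ 1)"
    unfolding energy_solution_def
    using dX energy DERIV_cong[OF dW1]
    by (auto simp: poly_pderiv_heis_quartic field_simps power2_eq_square power3_eq_cube)

  \<comment> \<open>A period of \<open>X\<close> is a period of the whole frame velocity
    \<open>W\<close>, so the shifted curve and \<open>\<sigma>\<close> have the same left-invariant
    velocity and differ by a left translation.\<close>
  have shift: "\<sigma> (t + \<omega>) = \<sigma> \<omega> \<odot> \<sigma> t" if "\<And>t. X (t + \<omega>) = X t" for \<omega> t
  proof -
    have "W (t + \<omega>) $ 1 = W t $ 1" for t
    proof (rule DERIV_unique)
      show "(X has_real_derivative W t $ 1) (at t)" by (rule dX)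
      have "((\<lambda>t. X (t + \<omega>)) has_real_derivative W (t + \<omega>) $ 1) (at t)"
        using dX DERIV_shift by blast
      then show "(X has_real_derivative W (t + \<omega>) $ 1) (at t)" by (simp add: that)
    qed
    moreover have "W (t + \<omega>) $ 2 = W t $ 2" for t unfolding W2 that ..
    moreover have "W (t + \<omega>) $ 3 = W t $ 3" for t using that[of t] by (simp add: X_def)
    ultimately have W: "W (t + \<omega>) = W t" for t by (simp add: vec_eq_iff forall_3)
    have "((\<lambda>t. \<sigma> (t + \<omega>)) has_vector_derivative left_field (W t) (\<sigma> (t + \<omega>))) (at t)" for t
    proof -
      have "((\<lambda>t. t + \<omega>) has_vector_derivative 1) (at t)" by (auto intro!: derivative_eq_intros)
      from vector_diff_chain_at[OF this d(1)] show ?thesis by (simp add: o_def W)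
    qed
    from left_translate_unique[OF d(1) assms(3) this] show ?thesis by simp
  qed
  \<comment> \<open>The first coordinate of \<open>\<sigma>\<close> is \<open>X\<close> up to a
    constant, so a priori \<open>X\<close> only shifts by \<open>l $ 1\<close>. The second
    coordinate shows that the square of \<open>X\<close> is periodic.\<close>
  have periodic_X: "X (t + \<omega>) = X t" if l: "\<And>t. l \<odot> \<sigma> t = \<sigma> (t + \<omega>)" for l \<omega> t
  proof -
    note ds = has_vector_derivative_nth[OF d(1)]
    have "((\<lambda>t. \<sigma> t $ 1 - X t) has_real_derivative 0) (at t)" for t
      by (rule derivative_eq_intros ds dX refl)+ simp
    from const[OF this] have s1: "\<sigma> t $ 1 = X t - X 0" for t by (simp add: assms(3) algebra_simps)
    have 1: "X (t + \<omega>) = l $ 1 + X t" for t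
      using arg_cong[OF l[of t], of "\<lambda>v. v $ 1"] by (simp add: s1)
    have "W (t + \<omega>) $ 2 = W t $ 2" for t
    proof (rule DERIV_unique)
      show "((\<lambda>t. \<sigma> (t + \<omega>) $ 2) has_real_derivative W (t + \<omega>) $ 2) (at t)"
        using ds[of 2 "t + \<omega>"] DERIV_shift[of "\<lambda>t. \<sigma> t $ 2"] by simp
      show "((\<lambda>t. \<sigma> (t + \<omega>) $ 2) has_real_derivative W t $ 2) (at t)"
        unfolding l[symmetric] heis_mult_nth by (rule derivative_eq_intros ds refl)+ simp
    qed
    then have 2: "(X (t + \<omega>))\<^sup>2 = (X t)\<^sup>2" for t unfolding W2 by simp
    \<comment> \<open>A nonzero shift that preserves the square forces \<open>X\<close> to be the
      constant \<open>- (l $ 1) / 2\<close>, and a constant admits no nonzero shift.\<close>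
    have "l $ 1 = 0"
    proof (rule ccontr)
      assume nz: "l $ 1 \<noteq> 0"
      have "X t = - (l $ 1) / 2" for t
      proof -
        have "l $ 1 * (l $ 1 + 2 * X t) = 0"
          using 2[of t] unfolding 1 by (simp add: power2_eq_square algebra_simps)
        with nz show ?thesis by simp
      qed
      with 1 nz show False by auto
    qed
    with 1 show ?thesis by simp
  qed

  show ?thesis
  proof (intro conjI impI allI)
    fix r :: real
    assume eq: "x0 = 0 \<and> (y0 + 1) * (z0 + \<rho>) = \<rho>" and "r \<noteq> 0"
    have Xc: "X t = z0 + \<rho>" for t
      using energy_solution_at_double_root[OF sol, of 0 t] eq by (simp add: X0 heis_quartic_initial)
    have W: "W t = vector [0, y0, z0]" for t
    proof -
      have "W t $ 1 = 0" using energy[of t] eq by (simp add: Xc heis_quartic_initial)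
      moreover have "W t $ 2 = y0" using W2[of t] W2[of 0] by (simp add: Xc W0)
      moreover have "W t $ 3 = z0" using Xc[of t] by (simp add: X_def)
      ultimately show ?thesis by (simp add: vec_eq_iff forall_3)
    qed
    \<comment> \<open>The initial position is an equilibrium, so the frame velocity is constant and
      \<open>\<sigma>\<close> is a one-parameter subgroup.\<close>
    have "\<sigma> t = t *\<^sub>R vector [0, y0, z0]" for t
    proof -
      have f: "left_field (vector [0, y0, z0]) (t *\<^sub>R vector [0, y0, z0]) = vector [0, y0, z0]" for t
        by (simp add: vec_eq_iff forall_3)
      have "((\<lambda>t. t *\<^sub>R vector [0, y0, z0]) has_vector_derivative
          left_field (W t) (t *\<^sub>R vector [0, y0, z0])) (at t)" for t
        unfolding W f by (auto intro!: derivative_eq_intros)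
      from left_translate_unique[OF d(1) assms(3) this, of t] show ?thesis
        by (simp add: heis_group)
    qed
    then have l: "heis_exp (vector [0, y0 * r, z0 * r]) = \<sigma> r"
      by (simp add: heis_exp_def vec_eq_iff forall_3)
    have "\<sigma> (t + r) = \<sigma> r \<odot> \<sigma> t" for t by (rule shift) (simp add: Xc)
    then show "let l = heis_exp (vector [0, y0 * r, z0 * r]) in
        if l = 0 then \<forall>t. \<sigma> (t + r) = \<sigma> t else lambda_periodic_with l r \<sigma>"
      using \<open>r \<noteq> 0\<close> unfolding l Let_def lambda_periodic_with_def by (auto simp: heis_group)
  next
    assume "x0\<^sup>2 + (\<rho> - (y0 + 1) * (z0 + \<rho>))\<^sup>2 \<noteq> 0"
      and "heis_disc \<rho> x0 y0 z0 \<noteq> 0 \<or> heis_disc \<rho> x0 y0 z0 = 0 \<and> heis_mu \<rho> x0 y0 z0 > 0"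
    note per = heis_potential_periodic[OF this sol X0]
    show "let \<omega> = heis_period \<rho> x0 y0 z0 in
        if \<sigma> \<omega> = 0 then periodic_with \<omega> \<sigma> else lambda_periodic_with (\<sigma> \<omega>) \<omega> \<sigma>"
      using per shift[of "heis_period \<rho> x0 y0 z0"]
      unfolding Let_def periodic_with_def lambda_periodic_with_def by (auto simp: heis_group)
  next
    fix l
    assume nd: "x0\<^sup>2 + (\<rho> - (y0 + 1) * (z0 + \<rho>))\<^sup>2 \<noteq> 0"
      and z: "heis_disc \<rho> x0 y0 z0 = 0 \<and> heis_mu \<rho> x0 y0 z0 \<le> 0"
    obtain r a b where ab: "a < b"
      and P: "\<And>x. poly ?P x = - 1/4 * (x - r)\<^sup>2 * (x - a) * (x - b)"
      using heis_disc_zero[OF nd] z by metis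
    have "(r - a) * (r - b) \<le> 0" using heis_mu_double_root[OF P] ab z by simp
    then have r: "a \<le> r" "r \<le> b" using ab by (auto simp: mult_le_0_iff)
    show "\<not> lambda_periodic l \<sigma>"
    proof
      assume "lambda_periodic l \<sigma>"
      then obtain \<omega> where "\<omega> \<noteq> 0" "\<And>t. l \<odot> \<sigma> t = \<sigma> (t + \<omega>)"
        unfolding lambda_periodic_def lambda_periodic_with_def by blast
      then have "poly ?P (X 0) = 0 \<and> poly (pderiv ?P) (X 0) = 0"
        using energy_solution_homoclinic_not_periodic[OF sol P r] periodic_X by blast
      with nd show False by (auto simp: X0 heis_quartic_initial)
    qed
  qed
qed

end
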